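(* Let $\tilde\Gamma_2(x,\varepsilon)=\gamma(x)+\varepsilon\gamma_1(x)+\varepsilon^2\gamma_2(x)$ and, for a solution $(x(t),y(t))$ of $$\frac{dx}{dt}=f(x,y),\qquad \frac{dy}{dt}=\frac1\varepsilon g(x,y),\qquad x(0)=x_0,\ y(0)=y_0,$$ let $z(t)=y(t)-\tilde\Gamma_2(x(t),\varepsilon)$. Then there exists a constant $C>0$ independent of $\varepsilon$ such that, for all sufficiently small $\varepsilon>0$ (and all $t\ge 0$, for arbitrary initial values), $$|z(t)|^2\le C\varepsilon^6+e^{-\frac{\beta}{\varepsilon}t}|z(0)|^2 .$$ In particular, as long as $t$ is sufficiently large, $|z(t)|=\mathcal O(\varepsilon^3)$.
   Context: Setting: $n_x,n_y\ge1$ are integers, $0<\varepsilon\le\varepsilon_0\ll1$, and $f:\mathbb R^{n_x}\times\mathbb R^{n_y}\to\mathbb R^{n_x}$, $g:\mathbb R^{n_x}\times\mathbb R^{n_y}\to\mathbb R^{n_y}$ are sufficiently smooth functions such that, for some integer $K\ge1$, $f\in W^{K,\infty}$ and $\nabla g\in W^{K,\infty}$, where $\|\xi\|_{k,\infty}=\max_{0\le j\le k}\|\nabla^j\xi\|_{L^\infty}$ is the $W^{k,\infty}$ norm. For each $x\in\mathbb R^{n_x}$ there is $\gamma(x)\in\mathbb R^{n_y}$ with $g(x,\gamma(x))=0$, and there is $\beta>0$ with $\langle g(x,y)-g(x,\tilde y),y-\tilde y\rangle\le-\beta|y-\tilde y|^2$ for all $x\in\mathbb R^{n_x}$, $y,\tilde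 y\in\mathbb R^{n_y}$ (so $\gamma(x)$ is unique). Definitions: Put $F(x)=f(x,\gamma(x))$, $F_y(x)=\left[\frac{\partial f^i}{\partial y^j}(x,\gamma(x))\right]_{i,j}$, $G_y(x)=\left[\frac{\partial g^i}{\partial y^j}(x,\gamma(x))\right]_{i,j}$ (an invertible matrix), $G_{yy}^{i,j,k}(x)=\frac{\partial^2g^i}{\partial y^j\partial y^k}(x,\gamma(x))$, and $$\gamma_1(x)=G_y(x)^{-1}\nabla\gamma(x)F(x),$$ $$\gamma_2(x)=G_y(x)^{-1}\Big(\nabla\gamma(x)F_y(x)\gamma_1(x)+\nabla\gamma_1(x)F(x)-\tfrac12\Big[\sum_{j,k=1}^{n_y}G_{yy}^{i,j,k}(x)\gamma_1^j(x)\gamma_1^k(x)\Big]_{i=1}^{n_y}\Big).$$ Here $\nabla\gamma$, $\nabla\gamma_1$ are Jacobian matrices ($n_y\times n_x$) and superscripts denote components.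
   Formalization: The integer K is taken to be at least 2 instead of at least 1 (with f of class C^K and g of class C^{K+1}); for K = 1 the claim fails, e.g. f = 1, g = c(x) − y with c'' = sin(x²). *)

theory Defs
  imports "HOL-Analysis.Analysis"
begin

section \<open>Smoothness and the spaces \<open>W\<^bsup>k,\<infinity>\<^esup>\<close>\<close>

text \<open>For basis vectors \<open>b\<^sub>1, \<dots>, b\<^sub>j\<close>, the function \<open>iter_partial [b\<^sub>1, \<dots>, b\<^sub>j] \<xi>\<close> is
  \<open>\<partial>\<^sub>b\<^sub>1 \<dots> \<partial>\<^sub>b\<^sub>j \<xi>\<close>. These functions, for all lists of \<open>j\<close> basis vectors, are the entries of
  the tensor \<open>\<nabla>\<^sup>j \<xi>\<close>.\<close>

primrec iter_partial ::
  "'a list \<Rightarrow> ('a::euclidean_space \<Rightarrow> 'b::euclidean_space) \<Rightarrow> 'a \<Rightarrow> 'b" where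
  "iter_partial [] \<xi> = \<xi>"
| "iter_partial (b # bs) \<xi> = (\<lambda>p. frechet_derivative (iter_partial bs \<xi>) (at p) b)"

definition class_C :: "nat \<Rightarrow> ('a::euclidean_space \<Rightarrow> 'b::euclidean_space) \<Rightarrow> bool" where
  "class_C k \<xi> \<longleftrightarrow>
     (\<forall>bs. set bs \<subseteq> Basis \<and> length bs < k \<longrightarrow> (\<forall>p. iter_partial bs \<xi> differentiable (at p))) \<and>
     (\<forall>bs. set bs \<subseteq> Basis \<and> length bs \<le> k \<longrightarrow> continuous_on UNIV (iter_partial bs \<xi>))"

definition L_infty :: "('a::euclidean_space \<Rightarrow> 'b::euclidean_space) \<Rightarrow> bool" where
  "L_infty h \<longleftrightarrow> h \<in> borel_measurable lebesgue \<and> (\<exists>B. AE p in lebesgue. norm (h p) \<le> B)"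

text \<open>Finiteness of \<open>max\<^bsub>0 \<le> j \<le> k\<^esub> \<parallel>\<nabla>\<^sup>j \<xi>\<parallel>\<^bsub>L\<^sup>\<infinity>\<^esub>\<close>, that is, all entries of \<open>\<nabla>\<^sup>j \<xi>\<close> with
  \<open>j \<le> k\<close> are in \<open>L\<^sup>\<infinity>\<close>. The derivatives are classical ones, so the predicate is meaningful only
  together with \<open>class_C k \<xi>\<close>.\<close>

definition W_infty :: "nat \<Rightarrow> ('a::euclidean_space \<Rightarrow> 'b::euclidean_space) \<Rightarrow> bool" where
  "W_infty k \<xi> \<longleftrightarrow>
     (\<forall>bs. set bs \<subseteq> Basis \<and> length bs \<le> k \<longrightarrow> L_infty (iter_partial bs \<xi>))"

text \<open>\<open>\<nabla>\<xi> \<in> W\<^bsup>k,\<infinity>\<^esup>\<close>, expressed through the columns \<open>\<partial>\<^sub>b \<xi>\<close> of the Jacobian.\<close>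

definition grad_W_infty :: "nat \<Rightarrow> ('a::euclidean_space \<Rightarrow> 'b::euclidean_space) \<Rightarrow> bool" where
  "grad_W_infty k \<xi> \<longleftrightarrow>
     (\<forall>b\<in>Basis. W_infty k (\<lambda>p. frechet_derivative \<xi> (at p) b))"

section \<open>The fast-slow system and the expansion of its slow manifold\<close>

definition fast_slow_solution ::
  "((real^'n) \<times> (real^'m) \<Rightarrow> real^'n) \<Rightarrow> ((real^'n) \<times> (real^'m) \<Rightarrow> real^'m) \<Rightarrow> real \<Rightarrow>
   real^'n \<Rightarrow> real^'m \<Rightarrow> (real \<Rightarrow> real^'n) \<Rightarrow> (real \<Rightarrow> real^'m) \<Rightarrow> bool" where
  "fast_slow_solution f g \<epsilon> x0 y0 x y \<longleftrightarrow>
     x 0 = x0 \<and> y 0 = y0 \<and>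
     (\<forall>t\<ge>0. (x has_vector_derivative f (x t, y t)) (at t within {0..}) \<and>
            (y has_vector_derivative (1 / \<epsilon>) *\<^sub>R g (x t, y t)) (at t within {0..}))"

text \<open>The parameter \<open>\<gamma>\<close> below is the zero of \<open>g(x, \<cdot>)\<close>, as a function of \<open>x\<close>.\<close>

definition slow_F ::
  "((real^'n) \<times> (real^'m) \<Rightarrow> real^'n) \<Rightarrow> (real^'n \<Rightarrow> real^'m) \<Rightarrow> real^'n \<Rightarrow> real^'n" where
  "slow_F f \<gamma> x = f (x, \<gamma> x)"

definition slow_Fy ::
  "((real^'n) \<times> (real^'m) \<Rightarrow> real^'n) \<Rightarrow> (real^'n \<Rightarrow> real^'m) \<Rightarrow> real^'n \<Rightarrow> real^'m^'n" where
  "slow_Fy f \<gamma> x = jacobian (\<lambda>y. f (x, y)) (at (\<gamma> x))"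

definition slow_Gy ::
  "((real^'n) \<times> (real^'m) \<Rightarrow> real^'m) \<Rightarrow> (real^'n \<Rightarrow> real^'m) \<Rightarrow> real^'n \<Rightarrow> real^'m^'m" where
  "slow_Gy g \<gamma> x = jacobian (\<lambda>y. g (x, y)) (at (\<gamma> x))"

definition partial_deriv :: "'m \<Rightarrow> (real^'m \<Rightarrow> real) \<Rightarrow> real^'m \<Rightarrow> real" where
  "partial_deriv j h y = frechet_derivative h (at y) (axis j 1)"

definition slow_Gyy ::
  "((real^'n) \<times> (real^'m) \<Rightarrow> real^'m) \<Rightarrow> (real^'n \<Rightarrow> real^'m) \<Rightarrow>
   'm \<Rightarrow> 'm \<Rightarrow> 'm \<Rightarrow> real^'n \<Rightarrow> real" where
  "slow_Gyy g \<gamma> i j k x = partial_deriv j (partial_deriv k (\<lambda>y. g (x, y) $ i)) (\<gamma> x)"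

definition gamma1 ::
  "((real^'n) \<times> (real^'m) \<Rightarrow> real^'n) \<Rightarrow> ((real^'n) \<times> (real^'m) \<Rightarrow> real^'m) \<Rightarrow>
   (real^'n \<Rightarrow> real^'m) \<Rightarrow> real^'n \<Rightarrow> real^'m" where
  "gamma1 f g \<gamma> x = matrix_inv (slow_Gy g \<gamma> x) *v (jacobian \<gamma> (at x) *v slow_F f \<gamma> x)"

definition gamma2 ::
  "((real^'n) \<times> (real^'m) \<Rightarrow> real^'n) \<Rightarrow> ((real^'n) \<times> (real^'m) \<Rightarrow> real^'m) \<Rightarrow>
   (real^'n \<Rightarrow> real^'m) \<Rightarrow> real^'n \<Rightarrow> real^'m" where
  "gamma2 f g \<gamma> x =
     matrix_inv (slow_Gy g \<gamma> x) *v
       (jacobian \<gamma> (at x) *v (slow_Fy f \<gamma> x *v gamma1 f g \<gamma> x)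
        + jacobian (gamma1 f g \<gamma>) (at x) *v slow_F f \<gamma> x
        - (1 / 2) *\<^sub>R (\<chi> i. \<Sum>j\<in>UNIV. \<Sum>k\<in>UNIV.
            slow_Gyy g \<gamma> i j k x * gamma1 f g \<gamma> x $ j * gamma1 f g \<gamma> x $ k))"

definition Gamma2_approx ::
  "((real^'n) \<times> (real^'m) \<Rightarrow> real^'n) \<Rightarrow> ((real^'n) \<times> (real^'m) \<Rightarrow> real^'m) \<Rightarrow>
   (real^'n \<Rightarrow> real^'m) \<Rightarrow> real^'n \<Rightarrow> real \<Rightarrow> real^'m" where
  "Gamma2_approx f g \<gamma> x \<epsilon> = \<gamma> x + \<epsilon> *\<^sub>R gamma1 f g \<gamma> x + \<epsilon>^2 *\<^sub>R gamma2 f g \<gamma> x"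

end

theory Submission
  imports Defs
begin

text \<open>Implicit differentiation of \<open>g(x, \<gamma>(x)) = 0\<close> and of the linear equations for \<open>\<gamma>\<^sub>1\<close> and \<open>\<gamma>\<^sub>2\<close>,
  whose coefficient matrix \<open>G\<^sub>y\<close> has a bounded inverse by dissipativity, bounds \<open>\<nabla>\<gamma>\<close> and
  \<open>\<gamma>\<^sub>1\<close> together with two derivatives, and \<open>\<gamma>\<^sub>2\<close> with one. These linear equations are the orders \<open>\<epsilon>\<close> and
  \<open>\<epsilon>\<^sup>2\<close> of the invariance equation \<open>g(x, \<Gamma>) = \<epsilon> \<nabla>\<Gamma> f(x, \<Gamma>)\<close>, so Taylor expansion shows that
  \<open>\<Gamma> = \<gamma> + \<epsilon> \<gamma>\<^sub>1 + \<epsilon>\<^sup>2 \<gamma>\<^sub>2\<close> satisfies it up to \<open>O(\<epsilon>\<^sup>3)\<close>. Dissipativity and Young's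
  inequality then give \<open>\<epsilon> (|z|\<^sup>2)' \<le> - \<beta> |z|\<^sup>2 + C \<epsilon>\<^sup>6\<close>, and Gronwall's lemma concludes.\<close>

section \<open>Functions with bounded partial derivatives\<close>

text \<open>A trajectory may leave every bounded set, so each constant has to be uniform over the
  whole space; compactness is of no help. Moreover \<open>g\<close> and \<open>\<gamma>\<close> may
  themselves grow and only their gradients are controlled. Hence two predicates:
  \<open>bounded_derivs\<close> for full bounds, \<open>bounded_gradient\<close> for bounds that
  start at the first derivative. Each coefficient costs a derivative:
  \<open>\<gamma>\<^sub>1\<close> contains the gradient of \<open>\<gamma>\<close>,
  \<open>\<gamma>\<^sub>2\<close> that of \<open>\<gamma>\<^sub>1\<close>, and the residual that of
  \<open>\<gamma>\<^sub>2\<close>. Two bounded derivatives of \<open>f\<close> and of the gradient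
  of \<open>g\<close> pay for this chain and for the cubic Taylor remainder of \<open>g\<close>;
  this is the role of \<open>2 \<le> K\<close>. The analysis is carried out with Frechet derivatives
  in Euclidean spaces, and derivatives of higher order are iterated partial derivatives, so that
  every induction stays within functions of one fixed type. The matrices and index sums of the
  definitions are translated into this language only at the end.\<close>

primrec bounded_derivs ::
  "nat \<Rightarrow> ('a::euclidean_space \<Rightarrow> 'b::euclidean_space) \<Rightarrow> bool" where
  "bounded_derivs 0 h \<longleftrightarrow> (\<exists>B. \<forall>x. norm (h x) \<le> B)"
| "bounded_derivs (Suc k) h \<longleftrightarrow> (\<exists>B. \<forall>x. norm (h x) \<le> B) \<and> (\<forall>x. h differentiable (at x)) \<and>
     (\<forall>b\<in>Basis. bounded_derivs k (\<lambda>x. frechet_derivative h (at x) b))"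

text \<open>The index counts derivatives of the gradient: derivatives of h of orders 1 to
  \<open>Suc k\<close> are bounded, while h may grow, as \<open>g\<close>, \<open>\<gamma>\<close>
  and the graph map \<open>\<lambda>x. (x, \<gamma> x)\<close> may.\<close>

definition bounded_gradient ::
  "nat \<Rightarrow> ('a::euclidean_space \<Rightarrow> 'b::euclidean_space) \<Rightarrow> bool" where
  "bounded_gradient k h \<longleftrightarrow> (\<forall>x. h differentiable (at x)) \<and>
     (\<forall>b\<in>Basis. bounded_derivs k (\<lambda>x. frechet_derivative h (at x) b))"

lemma bounded_derivs_Suc_iff:
  "bounded_derivs (Suc k) h \<longleftrightarrow> bounded_derivs 0 h \<and> bounded_gradient k h"
  by (auto simp: bounded_gradient_def)

lemma bounded_derivs_imp_bounded: "bounded_derivs k h \<Longrightarrow> bounded_derivs 0 h"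
  by (cases k) auto

lemma bounded_derivs_Suc_imp: "bounded_derivs (Suc k) h \<Longrightarrow> bounded_derivs k h"
  by (induction k arbitrary: h) auto

lemma bounded_gradient_Suc_imp: "bounded_gradient (Suc k) h \<Longrightarrow> bounded_gradient k h"
  unfolding bounded_gradient_def using bounded_derivs_Suc_imp by blast

lemma bounded_derivs_mono: "j \<le> k \<Longrightarrow> bounded_derivs k h \<Longrightarrow> bounded_derivs j h"
  by (induction rule: inc_induct) (blast intro: bounded_derivs_Suc_imp)+

lemma bounded_gradient_mono: "j \<le> k \<Longrightarrow> bounded_gradient k h \<Longrightarrow> bounded_gradient j h"
  unfolding bounded_gradient_def using bounded_derivs_mono by blast

lemma bounded_gradientI:
  assumes "\<And>x. (h has_derivative h' x) (at x)" "\<And>b. b \<in> Basis \<Longrightarrow> bounded_derivs k (\<lambda>x. h' x b)"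
  shows "bounded_gradient k h"
proof -
  have "frechet_derivative h (at x) = h' x" for x
    using assms(1) frechet_derivative_at by metis
  then show ?thesis
    unfolding bounded_gradient_def using assms by (auto intro: differentiableI)
qed

lemma bounded_gradient_has_derivative:
  "bounded_gradient k h \<Longrightarrow> (h has_derivative frechet_derivative h (at x)) (at x)"
  unfolding bounded_gradient_def using frechet_derivative_works by blast

lemma bounded_derivs_const: "bounded_derivs k (\<lambda>_. c)"
proof (induction k arbitrary: c)
  case (Suc k)
  have "bounded_gradient k (\<lambda>_::'a. c)"
    using Suc by (intro bounded_gradientI[where h' = "\<lambda>_ _. 0"]) auto
  then show ?case
    unfolding bounded_derivs_Suc_iff by auto
qed auto

lemma bounded_derivs_add:
  assumes "bounded_derivs k h" "bounded_derivs k h'"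
  shows "bounded_derivs k (\<lambda>x. h x + h' x)"
  using assms
proof (induction k arbitrary: h h')
  case 0
  then obtain B B' where "\<And>x. norm (h x) \<le> B" "\<And>x. norm (h' x) \<le> B'" by auto
  then have "norm (h x + h' x) \<le> B + B'" for x
    by (simp add: norm_triangle_mono)
  then show ?case by auto
next
  case (Suc k)
  have "bounded_gradient k (\<lambda>x. h x + h' x)"
    using Suc.prems[unfolded bounded_derivs_Suc_iff] Suc.IH
    by (intro bounded_gradientI[OF has_derivative_add[OF
          bounded_gradient_has_derivative bounded_gradient_has_derivative]])
      (auto simp: bounded_gradient_def)
  moreover have "bounded_derivs 0 (\<lambda>x. h x + h' x)"
    by (rule bounded_derivs_imp_bounded[OF Suc.IH])
      (use Suc.prems in \<open>blast dest: bounded_derivs_Suc_imp\<close>)+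
  ultimately show ?case unfolding bounded_derivs_Suc_iff by blast
qed

lemma bounded_derivs_sum:
  assumes "finite I" "\<And>i. i \<in> I \<Longrightarrow> bounded_derivs k (h i)"
  shows "bounded_derivs k (\<lambda>x. \<Sum>i\<in>I. h i x)"
  using assms by (induction I rule: finite_induct) (auto intro: bounded_derivs_const bounded_derivs_add)

text \<open>By the product rule a partial derivative is a sum of two products of the same kind with
  one factor differentiated, so the induction keeps both factors arbitrary and lowers the order of
  the undifferentiated one.\<close>

lemma bounded_derivs_bilinear:
  assumes P: "bounded_bilinear P" and "bounded_derivs k h" "bounded_derivs k h'"
  shows "bounded_derivs k (\<lambda>x. P (h x) (h' x))"
  using assms(2,3)
proof (induction k arbitrary: h h')
  case 0
  then obtain B B' where B: "\<And>x. norm (h x) \<le> B" "\<And>x. norm (h' x) \<le> B'" by auto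
  obtain K where K: "K \<ge> 0" "\<And>u v. norm (P u v) \<le> norm u * norm v * K"
    using bounded_bilinear.nonneg_bounded[OF P] by blast
  have "norm (P (h x) (h' x)) \<le> B * B' * K" for x
    by (rule order_trans[OF K(2)])
      (use B K order_trans[OF norm_ge_zero B(1)] in \<open>intro mult_right_mono mult_mono; auto\<close>)
  then show ?case by auto
next
  case (Suc k)
  have "bounded_gradient k (\<lambda>x. P (h x) (h' x))"
    using Suc.prems[unfolded bounded_derivs_Suc_iff] Suc.IH Suc.prems[THEN bounded_derivs_Suc_imp]
    by (intro bounded_gradientI[OF bounded_bilinear.FDERIV[OF P
          bounded_gradient_has_derivative bounded_gradient_has_derivative]])
      (auto simp: bounded_gradient_def intro!: bounded_derivs_add)
  moreover have "bounded_derivs 0 (\<lambda>x. P (h x) (h' x))"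
    by (rule bounded_derivs_imp_bounded[OF Suc.IH])
      (use Suc.prems in \<open>blast dest: bounded_derivs_Suc_imp\<close>)+
  ultimately show ?case unfolding bounded_derivs_Suc_iff by blast
qed

text \<open>A linear map is the bilinear map \<open>r *\<^sub>R L u\<close> at r = 1, so the product
  lemma with a constant factor replaces a second induction.\<close>

lemma bounded_derivs_linear:
  assumes L: "bounded_linear L" and h: "bounded_derivs k h"
  shows "bounded_derivs k (\<lambda>x. L (h x))"
proof -
  have "bounded_bilinear (\<lambda>r u. r *\<^sub>R L u)"
    by (rule bounded_bilinear.comp[OF bounded_bilinear_scaleR bounded_linear_ident L])
  from bounded_derivs_bilinear[OF this bounded_derivs_const[of k 1] h]
  show ?thesis by simp
qed

lemmas bounded_derivs_scaleR = bounded_derivs_bilinear[OF bounded_bilinear_scaleR]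

lemma bounded_derivs_inner_const: "bounded_derivs k h \<Longrightarrow> bounded_derivs k (\<lambda>x. h x \<bullet> c)"
  by (rule bounded_derivs_linear[OF bounded_linear_inner_left])

text \<open>Turns a derivative evaluated at a moving vector into a finite sum of scalar functions
  times partial derivatives, the form to which the closure lemmas apply.\<close>

lemma linear_Basis_expansion:
  fixes L :: "'a::euclidean_space \<Rightarrow> 'b::real_vector"
  assumes "linear L" shows "L u = (\<Sum>c\<in>Basis. (u \<bullet> c) *\<^sub>R L c)"
proof -
  have "L u = L (\<Sum>c\<in>Basis. (u \<bullet> c) *\<^sub>R c)" by (simp add: euclidean_representation)
  also have "\<dots> = (\<Sum>c\<in>Basis. (u \<bullet> c) *\<^sub>R L c)"
    using assms by (simp add: linear_sum linear_scale)
  finally show ?thesis .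
qed

text \<open>The inner map needs bounds on its gradient only, since boundedness of the composite
  comes from h. Its order k is one below that of the conclusion, which later permits a bootstrap for
  \<open>\<gamma>\<close>.\<close>

lemma bounded_derivs_compose:
  fixes \<phi> :: "'a::euclidean_space \<Rightarrow> 'b::euclidean_space" and h :: "'b \<Rightarrow> 'c::euclidean_space"
  assumes "bounded_derivs (Suc k) h" and "bounded_gradient k \<phi>"
  shows "bounded_derivs (Suc k) (\<lambda>x. h (\<phi> x))"
  using assms
proof (induction k arbitrary: h)
  \<comment> \<open>The chain rule, with the bound on the partial derivatives of h along \<phi> as a
    hypothesis: in the base case that bound is immediate, in the step it is the induction
    hypothesis.\<close>
  have chain: "bounded_gradient k (\<lambda>x. h (\<phi> x))"
    if h: "bounded_gradient k h" and \<phi>: "bounded_gradient k \<phi>"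
      and c: "\<And>c. c \<in> Basis \<Longrightarrow> bounded_derivs k (\<lambda>x. frechet_derivative h (at (\<phi> x)) c)"
    for k and h :: "'b \<Rightarrow> 'c"
  proof (rule bounded_gradientI)
    show "((\<lambda>x. h (\<phi> x)) has_derivative
        (\<lambda>u. frechet_derivative h (at (\<phi> x)) (frechet_derivative \<phi> (at x) u))) (at x)" for x
      using has_derivative_compose[OF bounded_gradient_has_derivative[OF \<phi>]
          bounded_gradient_has_derivative[OF h]] .
    fix b :: 'a assume b: "b \<in> Basis"
    have lin: "linear (frechet_derivative h (at y))" for y
      by (rule has_derivative_linear[OF bounded_gradient_has_derivative[OF h]])
    show "bounded_derivs k (\<lambda>x. frechet_derivative h (at (\<phi> x)) (frechet_derivative \<phi> (at x) b))"
      unfolding linear_Basis_expansion[OF lin, of _ "frechet_derivative \<phi> (at _) b"]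
      using \<phi> b c
      by (intro bounded_derivs_sum bounded_derivs_scaleR bounded_derivs_inner_const)
        (auto simp: bounded_gradient_def)
  qed
  have bnd: "bounded_derivs 0 (\<lambda>x. h (\<phi> x))" if "bounded_derivs 0 h" for h :: "'b \<Rightarrow> 'c"
    using that by auto
  {
    case (0 h)
    then show ?case
      unfolding bounded_derivs_Suc_iff[of 0 h] bounded_derivs_Suc_iff[of 0 "\<lambda>x. h (\<phi> x)"]
      by (intro conjI chain bnd) (auto simp: bounded_gradient_def simp del: bounded_derivs.simps intro: bnd)
  next
    case (Suc k h)
    have "bounded_derivs (Suc k) (\<lambda>x. frechet_derivative h (at (\<phi> x)) c)" if "c \<in> Basis" for c
      using Suc.prems that
      by (intro Suc.IH bounded_gradient_Suc_imp[of k \<phi>]) simp_all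
    with Suc.prems show ?case
      unfolding bounded_derivs_Suc_iff[of "Suc k"]
      by (intro conjI chain bnd) simp_all
  }
qed

section \<open>Zeros of dissipative maps\<close>

text \<open>Cauchy-Schwarz, after cancelling one factor \<open>norm (y - y')\<close>. It makes zeros
  stable: a defect of size r moves the zero by at most r/\<beta>.\<close>

lemma dissipative_dist_le:
  fixes y y' p q :: "'b::real_inner"
  assumes "\<beta> > 0" "(p - q) \<bullet> (y - y') \<le> - \<beta> * (norm (y - y'))\<^sup>2"
  shows "\<beta> * norm (y - y') \<le> norm (p - q)"
proof -
  have "\<beta> * norm (y - y') * norm (y - y') \<le> - ((p - q) \<bullet> (y - y'))"
    using assms by (simp add: power2_eq_square mult.assoc)
  also have "\<dots> \<le> norm (p - q) * norm (y - y')"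
    using Cauchy_Schwarz_ineq2[of "p - q" "y - y'"] by linarith
  finally show ?thesis
    by (cases "y = y'") auto
qed

text \<open>Dissipativity between y and y + h u, divided by h^2, bounds the difference quotient in
  direction (0, u) tested with u, and the bound passes to the limit. Only h > 0 is used, so the
  divisions keep the inequality.\<close>

lemma dissipative_imp_coercive:
  fixes G :: "'a::euclidean_space \<times> 'b::euclidean_space \<Rightarrow> 'b"
  assumes G: "(G has_derivative G') (at (x, y))"
    and diss: "\<And>y y'. (G (x, y) - G (x, y')) \<bullet> (y - y') \<le> - \<beta> * (norm (y - y'))\<^sup>2"
  shows "G' (0, u) \<bullet> u \<le> - \<beta> * (norm u)\<^sup>2"
proof -
  have "((\<lambda>s::real. G (x, y + s *\<^sub>R u)) has_derivative (\<lambda>s. G' (0, s *\<^sub>R u))) (at 0)"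
    by (rule has_derivative_compose[of "\<lambda>s. (x, y + s *\<^sub>R u)" "\<lambda>s. (0, s *\<^sub>R u)" 0 UNIV G G'])
      (use G in \<open>auto intro!: derivative_eq_intros\<close>)
  then have "((\<lambda>s::real. G (x, y + s *\<^sub>R u) \<bullet> u) has_derivative (\<lambda>s. G' (0, s *\<^sub>R u) \<bullet> u)) (at 0)"
    by (rule has_derivative_inner_left)
  moreover have "(\<lambda>s. G' (0, s *\<^sub>R u) \<bullet> u) = (\<lambda>s. (G' (0, u) \<bullet> u) * s)"
  proof
    fix s :: real
    have "G' (s *\<^sub>R (0, u)) = s *\<^sub>R G' (0, u)"
      by (rule linear_scale[OF has_derivative_linear[OF G]])
    then show "G' (0, s *\<^sub>R u) \<bullet> u = (G' (0, u) \<bullet> u) * s"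
      by simp
  qed
  ultimately have "((\<lambda>s::real. G (x, y + s *\<^sub>R u) \<bullet> u) has_real_derivative (G' (0, u) \<bullet> u)) (at 0)"
    by (simp add: has_field_derivative_def)
  then have lim: "((\<lambda>h. (G (x, y + h *\<^sub>R u) \<bullet> u - G (x, y) \<bullet> u) / h) \<longlongrightarrow> G' (0, u) \<bullet> u) (at_right 0)"
    by (simp add: DERIV_def filterlim_at_split)
  show ?thesis
  proof (rule tendsto_upperbound[OF lim])
    show "\<forall>\<^sub>F h in at_right 0. (G (x, y + h *\<^sub>R u) \<bullet> u - G (x, y) \<bullet> u) / h \<le> - \<beta> * (norm u)\<^sup>2"
    proof (rule eventually_at_right_less[THEN eventually_mono])
      fix h :: real assume h: "0 < h"
      have "h * (G (x, y + h *\<^sub>R u) \<bullet> u - G (x, y) \<bullet> u) \<le> h * (h * (- \<beta> * (norm u)\<^sup>2))"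
        using diss[of "y + h *\<^sub>R u" y] h
        by (simp add: inner_diff_left power_mult_distrib power2_eq_square algebra_simps)
      then have "G (x, y + h *\<^sub>R u) \<bullet> u - G (x, y) \<bullet> u \<le> h * (- \<beta> * (norm u)\<^sup>2)"
        using h by (simp only: mult_le_cancel_left_pos)
      then show "(G (x, y + h *\<^sub>R u) \<bullet> u - G (x, y) \<bullet> u) / h \<le> - \<beta> * (norm u)\<^sup>2"
        using h by (simp add: pos_divide_le_eq mult.commute)
    qed
  qed simp
qed

lemma coercive_inj:
  fixes L :: "'b::euclidean_space \<Rightarrow> 'b"
  assumes "linear L" "\<beta> > 0" "\<And>u. L u \<bullet> u \<le> - \<beta> * (norm u)\<^sup>2"
  shows "inj L"
  unfolding linear_injective_0[OF assms(1)]
proof (intro allI impI)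
  fix u assume "L u = 0"
  then have "\<beta> * (norm u)\<^sup>2 \<le> 0" using assms(3)[of u] by simp
  then show "u = 0" using assms(2) by (simp add: mult_le_0_iff)
qed

text \<open>Unlike in the implicit function theorem, differentiability at the single point is enough:
  dissipativity provides the Lipschitz estimate of \<open>v\<close>.\<close>

lemma implicit_zero_differentiable:
  fixes G :: "'a::euclidean_space \<times> 'b::euclidean_space \<Rightarrow> 'b" and v :: "'a \<Rightarrow> 'b"
  assumes G: "(G has_derivative G') (at (x, v x))"
    and zero: "\<And>x. G (x, v x) = 0" and \<beta>: "\<beta> > 0"
    and diss: "\<And>x y y'. (G (x, y) - G (x, y')) \<bullet> (y - y') \<le> - \<beta> * (norm (y - y'))\<^sup>2"
  shows "v differentiable (at x)"
proof -
  let ?T = "\<lambda>u. G' (0, u)"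
  have linG: "linear G'" using has_derivative_linear[OF G] .
  have G'_split: "G' (h, u) = G' (h, 0) + G' (0, u)" for h u
    using linear_add[OF linG, of "(h, 0)" "(0, u)"] by simp
  have linT: "linear ?T"
    using linear_compose[OF _ linG, of "\<lambda>u. (0, u)"]
    by (simp add: o_def bounded_linear_Pair bounded_linear.linear bounded_linear_zero bounded_linear_ident)
  have linH: "linear (\<lambda>h. G' (h, 0))"
    using linear_compose[OF _ linG, of "\<lambda>h. (h, 0)"]
    by (simp add: o_def bounded_linear_Pair bounded_linear.linear bounded_linear_zero bounded_linear_ident)
  have "inj ?T"
    by (rule coercive_inj[OF linT \<beta> dissipative_imp_coercive[OF G diss]])
  then obtain S where S: "linear S" "S \<circ> ?T = id"
    using linear_injective_left_inverse[OF linT] by blast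
  have ST: "S (?T u) = u" for u using S(2) by (metis comp_apply id_apply)
  \<comment> \<open>The derivative predicted by implicit differentiation: minus the inverse of the
    y-part of \<open>G'\<close> applied to its x-part.\<close>
  define v' where "v' = (\<lambda>h. - S (G' (h, 0)))"
  have lin_v': "bounded_linear v'"
    unfolding v'_def using linear_compose[OF linH S(1)]
    by (simp add: o_def linear_conv_bounded_linear bounded_linear_minus)
  obtain M where M: "M > 0" "\<And>p. norm (G' p) \<le> norm p * M"
    using bounded_linear.pos_bounded[OF has_derivative_bounded_linear[OF G]] by blast
  obtain N where N: "N > 0" "\<And>p. norm (S p) \<le> norm p * N"
    using bounded_linear.pos_bounded S(1) linear_conv_bounded_linear by metis
  \<comment> \<open>\<open>M\<close> bounds \<open>G'\<close>, and 1 is the tolerance with which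
    \<open>d1\<close> is chosen below; the division by \<beta> comes from dissipativity.\<close>
  define L where "L = (M + 1) / \<beta>"
  have L: "L > 0" using M \<beta> by (simp add: L_def)
  have approx: "\<exists>d>0. \<forall>p. norm (p - (x, v x)) < d \<longrightarrow>
      norm (G p - G' (p - (x, v x))) \<le> e * norm (p - (x, v x))" if "e > 0" for e
    using G that zero[of x] unfolding has_derivative_at_alt by simp
  obtain d1 where d1: "d1 > 0" "\<And>p. norm (p - (x, v x)) < d1 \<Longrightarrow>
      norm (G p - G' (p - (x, v x))) \<le> 1 * norm (p - (x, v x))"
    using approx[of 1] by auto
  \<comment> \<open>Dissipativity is used at the nearby parameter x': there v x is an approximate
    zero, with a defect that differentiability of G bounds by a multiple of
    \<open>norm (x' - x)\<close>.\<close>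
  have lip: "norm (v x' - v x) \<le> L * norm (x' - x)" if "norm (x' - x) < d1" for x'
  proof -
    have "\<beta> * norm (v x' - v x) \<le> norm (G (x', v x') - G (x', v x))"
      using dissipative_dist_le[OF \<beta> diss] .
    also have "\<dots> = norm (G (x', v x))" by (simp add: zero)
    also have "\<dots> \<le> norm (G (x', v x) - G' (x' - x, 0)) + norm (G' (x' - x, 0))"
      by (metis diff_add_cancel norm_triangle_ineq)
    also have "\<dots> \<le> norm (x' - x) + norm (x' - x) * M"
      using d1(2)[of "(x', v x)"] M(2)[of "(x' - x, 0)"] that by (simp add: norm_Pair)
    finally show ?thesis using \<beta> by (simp add: L_def field_simps)
  qed
  have "(v has_derivative v') (at x)"
    unfolding has_derivative_at_alt
  proof (intro conjI allI impI lin_v')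
    fix e :: real assume e: "e > 0"
    \<comment> \<open>The factor 1 + L passes from increments on the graph to increments of x, and N
      is lost in applying S; the choice makes the product equal to e.\<close>
    define e' where "e' = e / (N * (1 + L))"
    have e': "e' > 0" using e N L by (simp add: e'_def)
    obtain d where d: "d > 0" "\<And>p. norm (p - (x, v x)) < d \<Longrightarrow>
        norm (G p - G' (p - (x, v x))) \<le> e' * norm (p - (x, v x))"
      using approx[OF e'] by blast
    show "\<exists>d>0. \<forall>x'. norm (x' - x) < d \<longrightarrow> norm (v x' - v x - v' (x' - x)) \<le> e * norm (x' - x)"
    proof (intro exI[of _ "min d1 (d / (1 + L))"] conjI allI impI)
      show "0 < min d1 (d / (1 + L))" using d d1 L by simp
      fix x' assume "norm (x' - x) < min d1 (d / (1 + L))"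
      then have x': "norm (x' - x) < d1" "(1 + L) * norm (x' - x) < d"
        using L by (auto simp: pos_less_divide_eq mult.commute)
      have p: "norm ((x', v x') - (x, v x)) \<le> (1 + L) * norm (x' - x)"
        using norm_Pair_le[of "x' - x" "v x' - v x"] lip[OF x'(1)] by (simp add: algebra_simps)
      define r where "r = G (x', v x') - G' ((x', v x') - (x, v x))"
      have r: "norm r \<le> e' * ((1 + L) * norm (x' - x))"
        unfolding r_def using d(2)[of "(x', v x')"] p x' e' by (meson le_less_trans less_imp_le mult_left_mono order_trans)
      have "?T (v x' - v x) = - G' (x' - x, 0) - r"
        unfolding r_def using G'_split[of "x' - x" "v x' - v x"] by (simp add: zero)
      then have "v x' - v x = S (- G' (x' - x, 0) - r)"
        using ST by metis
      then have "v x' - v x - v' (x' - x) = - S r"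
        by (simp add: v'_def linear_diff[OF S(1)] linear_neg[OF S(1)])
      then have "norm (v x' - v x - v' (x' - x)) \<le> norm r * N"
        using N(2) by simp
      also have "\<dots> \<le> e' * ((1 + L) * norm (x' - x)) * N"
        using r N by (intro mult_right_mono) auto
      also have "\<dots> = e * norm (x' - x)"
        using N L by (simp add: e'_def)
      finally show "norm (v x' - v x - v' (x' - x)) \<le> e * norm (x' - x)" .
    qed
  qed
  then show ?thesis by (rule differentiableI)
qed

text \<open>Coercivity bounds v by the norm of w over \<beta>. A partial derivative of v solves a
  system with the same coefficients and right side \<partial>w - (\<partial>a) v, so an induction
  with arbitrary v and w closes. This takes the place of differentiating an inverse matrix.\<close>

lemma bounded_derivs_linear_system:
  fixes a :: "'b \<Rightarrow> 'a::euclidean_space \<Rightarrow> 'b::euclidean_space"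
  assumes "\<And>c. c \<in> Basis \<Longrightarrow> bounded_derivs k (a c)" "bounded_derivs k w"
    and "\<And>x. (\<Sum>c\<in>Basis. (v x \<bullet> c) *\<^sub>R a c x) = w x"
    and \<beta>: "\<beta> > 0" and "\<And>x u. (\<Sum>c\<in>Basis. (u \<bullet> c) *\<^sub>R a c x) \<bullet> u \<le> - \<beta> * (norm u)\<^sup>2"
  shows "bounded_derivs k v"
  using assms(1-3)
proof (induction k arbitrary: v w)
  case 0
  then obtain B where B: "\<And>x. norm (w x) \<le> B" by auto
  have "norm (v x) \<le> B / \<beta>" for x
    using dissipative_dist_le[of \<beta> "w x" 0 "v x" 0] assms(5)[of "v x" x] 0(3)[of x] \<beta> B[of x]
    by (simp add: field_simps)
  then show ?case by auto
next
  case (Suc k)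
  have a: "bounded_derivs k (a c)" "bounded_gradient k (a c)" if "c \<in> Basis" for c
    using Suc.prems(1)[OF that] bounded_derivs_Suc_imp bounded_derivs_Suc_iff by blast+
  have w: "bounded_derivs k w" "bounded_gradient k w"
    using Suc.prems(2) bounded_derivs_Suc_imp bounded_derivs_Suc_iff by blast+
  note a' = bounded_gradient_has_derivative[OF a(2)]
  note w' = bounded_gradient_has_derivative[OF w(2)]
  \<comment> \<open>Needed before differentiating, because v enters the right side of the
    differentiated system.\<close>
  have v: "bounded_derivs k v"
    by (rule Suc.IH[OF a(1) w(1) Suc.prems(3)])
  \<comment> \<open>v x is the zero of a map affine in y whose linear part is coercive. Such a map
    is dissipative, so its zero is differentiable in x.\<close>
  define G where "G = (\<lambda>p. (\<Sum>c\<in>Basis. (snd p \<bullet> c) *\<^sub>R a c (fst p)) - w (fst p))"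
  have "v differentiable (at x)" for x
  proof (rule implicit_zero_differentiable[of G])
    show "(G has_derivative (\<lambda>q. (\<Sum>c\<in>Basis. (v x \<bullet> c) *\<^sub>R frechet_derivative (a c) (at x) (fst q)
        + (snd q \<bullet> c) *\<^sub>R a c x) - frechet_derivative w (at x) (fst q))) (at (x, v x))"
    proof -
      have fst: "((\<lambda>p. h (fst p)) has_derivative (\<lambda>q. h' (fst q))) (at (x, v x))"
        if "(h has_derivative h') (at x)" for h h' and x :: 'a
        using has_derivative_compose[of fst fst "(x, v x)" UNIV h h'] that
        by (simp add: has_derivative_fst[OF has_derivative_ident])
      have snd: "((\<lambda>p. snd p \<bullet> c) has_derivative (\<lambda>q. snd q \<bullet> c)) F" for c :: 'b and F :: "('a \<times> 'b) filter"
        by (intro has_derivative_inner_left has_derivative_snd has_derivative_ident)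
      show ?thesis
        unfolding G_def
        using has_derivative_diff[OF has_derivative_sum[OF has_derivative_scaleR[OF snd fst[OF a']]] fst[OF w']]
        by simp
    qed
    show "G (x, v x) = 0" for x using Suc.prems(3) by (simp add: G_def)
    show "(G (x, y) - G (x, y')) \<bullet> (y - y') \<le> - \<beta> * (norm (y - y'))\<^sup>2" for x y y'
    proof -
      have "G (x, y) - G (x, y') = (\<Sum>c\<in>Basis. ((y - y') \<bullet> c) *\<^sub>R a c x)"
        by (simp add: G_def inner_diff_left scaleR_diff_left sum_subtractf)
      then show ?thesis using assms(5)[of "y - y'" x] by metis
    qed
  qed (rule \<beta>)
  then have v': "(v has_derivative frechet_derivative v (at x)) (at x)" for x
    using frechet_derivative_works by blast
  have eq: "(\<Sum>c\<in>Basis. (frechet_derivative v (at x) u \<bullet> c) *\<^sub>R a c x) =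
      frechet_derivative w (at x) u - (\<Sum>c\<in>Basis. (v x \<bullet> c) *\<^sub>R frechet_derivative (a c) (at x) u)"
    for x u
  proof -
    have "((\<lambda>x. \<Sum>c\<in>Basis. (v x \<bullet> c) *\<^sub>R a c x) has_derivative (\<lambda>u. \<Sum>c\<in>Basis.
        (v x \<bullet> c) *\<^sub>R frechet_derivative (a c) (at x) u + (frechet_derivative v (at x) u \<bullet> c) *\<^sub>R a c x)) (at x)"
      by (intro has_derivative_sum has_derivative_scaleR has_derivative_inner_left v' a')
    then have "(\<lambda>u. \<Sum>c\<in>Basis. (v x \<bullet> c) *\<^sub>R frechet_derivative (a c) (at x) u
        + (frechet_derivative v (at x) u \<bullet> c) *\<^sub>R a c x) = frechet_derivative w (at x)"
      unfolding Suc.prems(3) using has_derivative_unique w' by blast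
    then have "(\<Sum>c\<in>Basis. (v x \<bullet> c) *\<^sub>R frechet_derivative (a c) (at x) u
        + (frechet_derivative v (at x) u \<bullet> c) *\<^sub>R a c x) = frechet_derivative w (at x) u"
      by (rule fun_cong)
    then show ?thesis by (simp add: sum.distrib eq_diff_eq add.commute)
  qed
  have "bounded_derivs k (\<lambda>x. frechet_derivative v (at x) b)" if b: "b \<in> Basis" for b
  proof (rule Suc.IH[OF a(1)])
    have "bounded_derivs k (\<lambda>x. frechet_derivative w (at x) b
        + (- 1) *\<^sub>R (\<Sum>c\<in>Basis. (v x \<bullet> c) *\<^sub>R frechet_derivative (a c) (at x) b))"
      using b a(2) w(2) v
      by (intro bounded_derivs_add bounded_derivs_sum bounded_derivs_scaleR bounded_derivs_const
          bounded_derivs_inner_const) (auto simp: bounded_gradient_def)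
    then show "bounded_derivs k (\<lambda>x. frechet_derivative w (at x) b
        - (\<Sum>c\<in>Basis. (v x \<bullet> c) *\<^sub>R frechet_derivative (a c) (at x) b))"
      by simp
  qed (simp_all add: eq)
  then have "bounded_gradient k v"
    by (rule bounded_gradientI[OF v'])
  with bounded_derivs_imp_bounded[OF v] show ?case
    unfolding bounded_derivs_Suc_iff by blast
qed

section \<open>From \<open>W\<^bsup>k,\<infinity>\<^esup>\<close> to pointwise bounds\<close>

text \<open>The set where an essential bound fails is open by continuity and negligible, hence
  empty.\<close>

lemma L_infty_continuous_imp_bounded:
  assumes "L_infty h" "continuous_on UNIV h"
  shows "\<exists>B. \<forall>p. norm (h p) \<le> B"
proof -
  obtain B where B: "AE p in lebesgue. norm (h p) \<le> B"
    using assms(1) unfolding L_infty_def by blast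
  let ?S = "{p. B < norm (h p)}"
  have "open ?S"
    using assms(2) by (intro open_Collect_less continuous_intros) auto
  moreover have "negligible ?S"
    using B unfolding eventually_ae_filter
    by (auto simp: negligible_iff_null_sets not_le intro: null_sets_completion_subset)
  ultimately have "?S = {}" using open_not_negligible by blast
  then show ?thesis by (auto simp: not_less)
qed

lemma class_C_D:
  assumes "class_C k \<xi>" "set bs \<subseteq> Basis"
  shows "length bs < k \<Longrightarrow> iter_partial bs \<xi> differentiable (at p)"
    and "length bs \<le> k \<Longrightarrow> continuous_on UNIV (iter_partial bs \<xi>)"
  using assms unfolding class_C_def by blast+

text \<open>The lower length l serves two hypotheses at once: 0 if \<xi> itself is essentially
  bounded, 1 if only its derivatives are. Prepending a basis vector spends one of the remaining j
  derivatives.\<close>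

lemma bounded_derivs_iter_partial:
  assumes "class_C k \<xi>"
    and "\<And>bs. set bs \<subseteq> Basis \<Longrightarrow> l \<le> length bs \<Longrightarrow> length bs \<le> k \<Longrightarrow> L_infty (iter_partial bs \<xi>)"
    and "set bs \<subseteq> Basis" "l \<le> length bs" "length bs + j \<le> k"
  shows "bounded_derivs j (iter_partial bs \<xi>)"
  using assms(3-5)
proof (induction j arbitrary: bs)
  case 0
  then show ?case
    by (simp add: L_infty_continuous_imp_bounded assms(2) class_C_D(2)[OF assms(1)])
next
  case (Suc j)
  then have "\<exists>B. \<forall>p. norm (iter_partial bs \<xi> p) \<le> B"
    by (intro L_infty_continuous_imp_bounded assms(2) class_C_D(2)[OF assms(1)]) simp_all
  moreover have "iter_partial bs \<xi> differentiable (at p)" for p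
    using class_C_D(1)[OF assms(1)] Suc.prems by simp
  moreover have "bounded_derivs j (iter_partial (b # bs) \<xi>)" if "b \<in> Basis" for b
    using Suc.prems that by (intro Suc.IH) auto
  ultimately show ?case by simp
qed

lemma iter_partial_append:
  "iter_partial (bs @ bs') \<xi> = iter_partial bs (iter_partial bs' \<xi>)"
  by (induction bs) auto

lemma W_infty_imp_bounded_derivs:
  assumes "class_C k \<xi>" "W_infty k \<xi>"
  shows "bounded_derivs k \<xi>"
  using bounded_derivs_iter_partial[of k \<xi> 0 "[]" k] assms by (auto simp: W_infty_def)

lemma grad_W_infty_imp_bounded_gradient:
  assumes "class_C (Suc k) \<xi>" "grad_W_infty k \<xi>"
  shows "bounded_gradient k \<xi>"
proof -
  have "L_infty (iter_partial bs \<xi>)"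
    if bs: "set bs \<subseteq> Basis" "1 \<le> length bs" "length bs \<le> Suc k" for bs
  proof -
    \<comment> \<open>The last entry of the list is the derivative taken first; splitting it off
      exposes the column \<partial>\<xi> of which \<open>grad_W_infty\<close> speaks.\<close>
    obtain bs' b where "bs = bs' @ [b]"
      using bs(2) by (cases bs rule: rev_cases) auto
    then show ?thesis
      using bs assms(2) by (auto simp: grad_W_infty_def W_infty_def iter_partial_append)
  qed
  then have "bounded_derivs k (iter_partial [b] \<xi>)" if "b \<in> Basis" for b
    using that by (intro bounded_derivs_iter_partial[OF assms(1), of 1]) auto
  moreover have "iter_partial [] \<xi> differentiable (at p)" for p
    by (rule class_C_D(1)[OF assms(1)]) simp_all
  ultimately show ?thesis by (simp add: bounded_gradient_def)
qed

section \<open>Taylor estimates\<close>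

lemma bounded_gradient_linear: "bounded_gradient k h \<Longrightarrow> linear (frechet_derivative h (at p))"
  using has_derivative_linear[OF bounded_gradient_has_derivative] .

lemma bounded_gradient_bounded_derivs:
  "bounded_gradient k h \<Longrightarrow> b \<in> Basis \<Longrightarrow> bounded_derivs k (\<lambda>p. frechet_derivative h (at p) b)"
  by (simp add: bounded_gradient_def)

lemma bounded_gradient_imp_0: "bounded_gradient k h \<Longrightarrow> bounded_gradient 0 h"
  unfolding bounded_gradient_def using bounded_derivs_imp_bounded by blast

lemma bounded_derivs_imp_gradient: "bounded_derivs (Suc k) h \<Longrightarrow> bounded_gradient k h"
  unfolding bounded_derivs_Suc_iff by blast

text \<open>The constant is uniform in the parameter q. In the applications q is a pair of a point
  and an increment, and the weight w is a power of the norm of the increment, so bounds on partial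
  derivatives become bounds on the full derivative.\<close>

lemma Basis_bound_imp_bound:
  fixes L :: "'c \<Rightarrow> 'a::euclidean_space \<Rightarrow> 'b::real_normed_vector"
  assumes lin: "\<And>q. linear (L q)"
    and M: "\<And>b. b \<in> Basis \<Longrightarrow> \<exists>M. \<forall>q. norm (L q b) \<le> M * w q" and w: "\<And>q. w q \<ge> 0"
  shows "\<exists>C\<ge>0. \<forall>q u. norm (L q u) \<le> C * w q * norm u"
proof -
  obtain M where M: "\<And>b q. b \<in> Basis \<Longrightarrow> norm (L q b) \<le> M b * w q"
    using M by metis
  define C where "C = (\<Sum>b\<in>(Basis::'a set). \<bar>M b\<bar>)"
  have "norm (L q u) \<le> C * w q * norm u" for q u
  proof -
    have "norm (L q u) = norm (\<Sum>b\<in>Basis. (u \<bullet> b) *\<^sub>R L q b)"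
      using linear_Basis_expansion[OF lin] by metis
    also have "\<dots> \<le> (\<Sum>b\<in>Basis. norm u * (\<bar>M b\<bar> * w q))"
    proof (rule sum_norm_le)
      fix b :: 'a assume b: "b \<in> Basis"
      have "norm (L q b) \<le> \<bar>M b\<bar> * w q"
        using M[OF b, of q] w[of q] by (meson abs_ge_self mult_right_mono order_trans)
      then show "norm ((u \<bullet> b) *\<^sub>R L q b) \<le> norm u * (\<bar>M b\<bar> * w q)"
        using Basis_le_norm[OF b, of u] by (simp add: mult_mono)
    qed
    also have "\<dots> = C * w q * norm u"
      by (simp add: C_def sum_distrib_right sum_distrib_left mult_ac)
    finally show ?thesis .
  qed
  moreover have "C \<ge> 0" by (simp add: C_def sum_nonneg)
  ultimately show ?thesis by blast
qed

lemma bounded_gradient_bound: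
  assumes "bounded_gradient 0 h"
  shows "\<exists>C\<ge>0. \<forall>p u. norm (frechet_derivative h (at p) u) \<le> C * norm u"
  using Basis_bound_imp_bound[of "\<lambda>p. frechet_derivative h (at p)" "\<lambda>_. 1"]
    bounded_gradient_linear[OF assms] assms
  by (auto simp: bounded_gradient_def)

lemma bounded_gradient_Lipschitz:
  assumes "bounded_gradient 0 h"
  shows "\<exists>C\<ge>0. \<forall>p u. norm (h (p + u) - h p) \<le> C * norm u"
proof -
  obtain C where C: "C \<ge> 0" "\<And>p u. norm (frechet_derivative h (at p) u) \<le> C * norm u"
    using bounded_gradient_bound[OF assms] by blast
  have "norm (h (p + u) - h p) \<le> C * norm (p + u - p)" for p u
    by (rule differentiable_bound[of UNIV h "\<lambda>p. frechet_derivative h (at p)"])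
      (use C bounded_gradient_has_derivative[OF assms] in \<open>auto intro: onorm_le\<close>)
  with C(1) show ?thesis by auto
qed

lemma bounded_gradient_derivative_Lipschitz:
  assumes "bounded_gradient 1 h"
  shows "\<exists>C\<ge>0. \<forall>p u v. norm (frechet_derivative h (at (p + u)) v - frechet_derivative h (at p) v)
    \<le> C * norm u * norm v"
proof -
  have lin: "linear (frechet_derivative h (at p))" for p
    using bounded_gradient_linear[OF assms] .
  have "\<exists>C\<ge>0. \<forall>q v. norm (frechet_derivative h (at (fst q + snd q)) v - frechet_derivative h (at (fst q)) v)
      \<le> C * norm (snd q) * norm v"
  proof (rule Basis_bound_imp_bound)
    show "linear (\<lambda>v. frechet_derivative h (at (fst q + snd q)) v - frechet_derivative h (at (fst q)) v)" for q
      using linear_compose_sub[OF lin lin] .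
    fix b :: 'a assume b: "b \<in> Basis"
    have "bounded_gradient 0 (\<lambda>p. frechet_derivative h (at p) b)"
      using bounded_gradient_bounded_derivs[OF assms b] by (simp add: bounded_gradient_def)
    from bounded_gradient_Lipschitz[OF this]
    show "\<exists>M. \<forall>q. norm (frechet_derivative h (at (fst q + snd q)) b - frechet_derivative h (at (fst q)) b)
      \<le> M * norm (snd q)" by auto
  qed simp
  then show ?thesis by simp
qed

text \<open>Along the segment the derivative differs from its value at p by at most a multiple of
  \<open>norm u\<close>; the mean value inequality for h minus its linearization gives the second
  factor \<open>norm u\<close>.\<close>

lemma taylor_first_order:
  assumes "bounded_gradient 1 h"
  shows "\<exists>C\<ge>0. \<forall>p u. norm (h (p + u) - h p - frechet_derivative h (at p) u) \<le> C * (norm u)\<^sup>2"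
proof -
  obtain C where C: "C \<ge> 0" "\<And>p u v. norm (frechet_derivative h (at (p + u)) v
      - frechet_derivative h (at p) v) \<le> C * norm u * norm v"
    using bounded_gradient_derivative_Lipschitz[OF assms] by blast
  have "norm (h (p + u) - h p - frechet_derivative h (at p) (p + u - p)) \<le> norm (p + u - p) * (C * norm u)"
    for p u
  proof (rule differentiable_bound_linearization[of p "p + u" "(\<lambda>t. p + t *\<^sub>R u) ` {0..1}"])
    show "(h has_derivative frechet_derivative h (at q)) (at q within (\<lambda>t. p + t *\<^sub>R u) ` {0..1})" for q
      using has_derivative_at_withinI[OF bounded_gradient_has_derivative[OF assms]] .
    show "onorm (frechet_derivative h (at q) - frechet_derivative h (at p)) \<le> C * norm u"
      if q: "q \<in> (\<lambda>t. p + t *\<^sub>R u) ` {0..1}" for q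
    proof (rule onorm_le)
      fix v
      obtain t where "q = p + t *\<^sub>R u" "t \<in> {0..1}" using q by blast
      then have t: "q = p + t *\<^sub>R u" "0 \<le> t" "t \<le> 1" by auto
      have "norm ((frechet_derivative h (at q) - frechet_derivative h (at p)) v) \<le> C * norm (t *\<^sub>R u) * norm v"
        using C(2)[of p "t *\<^sub>R u" v] t by (simp add: fun_diff_def)
      also have "\<dots> \<le> C * norm u * norm v"
        using C(1) t by (intro mult_right_mono mult_left_mono) (auto simp: mult_left_le_one_le)
      finally show "norm ((frechet_derivative h (at q) - frechet_derivative h (at p)) v) \<le> C * norm u * norm v" .
    qed
  qed (auto intro: image_eqI[of _ _ 0])
  then have "norm (h (p + u) - h p - frechet_derivative h (at p) u) \<le> C * (norm u)\<^sup>2" for p u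
    by (simp add: power2_eq_square mult_ac)
  with C(1) show ?thesis by blast
qed

text \<open>The bilinear form D^2 h(p)(u, v). The direction v belongs to the inner derivative and is
  expanded in the basis because the hypotheses control the partial derivatives of h; u is the
  direction of the outer derivative.\<close>

definition second_derivative ::
  "('a::euclidean_space \<Rightarrow> 'b::euclidean_space) \<Rightarrow> 'a \<Rightarrow> 'a \<Rightarrow> 'a \<Rightarrow> 'b" where
  "second_derivative h p u v =
     (\<Sum>b\<in>Basis. (v \<bullet> b) *\<^sub>R frechet_derivative (\<lambda>q. frechet_derivative h (at q) b) (at p) u)"

lemma second_derivative_Basis:
  assumes "b \<in> Basis"
  shows "second_derivative h p u b = frechet_derivative (\<lambda>q. frechet_derivative h (at q) b) (at p) u"
proof -
  have "second_derivative h p u b = (\<Sum>c\<in>Basis. if c = b then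
      frechet_derivative (\<lambda>q. frechet_derivative h (at q) b) (at p) u else 0)"
    unfolding second_derivative_def by (rule sum.cong) (auto simp: inner_Basis assms)
  with assms show ?thesis by simp
qed

lemma bounded_gradient_partial:
  "bounded_gradient (Suc k) h \<Longrightarrow> b \<in> Basis \<Longrightarrow> bounded_gradient k (\<lambda>p. frechet_derivative h (at p) b)"
  using bounded_derivs_imp_gradient bounded_gradient_bounded_derivs by blast

lemma bounded_bilinear_second_derivative:
  assumes "bounded_gradient 1 h"
  shows "\<exists>C\<ge>0. \<forall>p u v. norm (second_derivative h p u v) \<le> C * norm u * norm v"
    and "bilinear (second_derivative h p)"
proof -
  have g: "bounded_gradient 0 (\<lambda>p. frechet_derivative h (at p) b)" if "b \<in> Basis" for b
    using bounded_gradient_partial[of 0] assms that by simp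
  have linv: "linear (second_derivative h p u)" for p u
    unfolding second_derivative_def
    by (intro linear_compose_sum ballI) (simp add: linear_iff inner_add_left scaleR_add_left)
  have linu: "linear (\<lambda>u. second_derivative h p u v)" for p v
    unfolding second_derivative_def
    by (intro linear_compose_sum linear_compose_scale_right ballI bounded_gradient_linear[OF g])
  show "bilinear (second_derivative h p)"
    unfolding bilinear_def using linv linu by blast
  have "\<exists>C\<ge>0. \<forall>q v. norm (second_derivative h (fst q) (snd q) v) \<le> C * norm (snd q) * norm v"
  proof (rule Basis_bound_imp_bound[OF linv])
    fix b :: 'a assume b: "b \<in> Basis"
    show "\<exists>M. \<forall>q. norm (second_derivative h (fst q) (snd q) b) \<le> M * norm (snd q)"
      using bounded_gradient_bound[OF g[OF b]] by (auto simp: second_derivative_Basis[OF b])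
  qed simp
  then show "\<exists>C\<ge>0. \<forall>p u v. norm (second_derivative h p u v) \<le> C * norm u * norm v"
    by simp
qed

text \<open>The first-order estimate for every partial derivative of h is an expansion of the whole
  derivative with error of order |u|^2; one more mean value argument along the segment raises this
  to |u|^3.\<close>

lemma taylor_second_order:
  assumes h: "bounded_gradient 2 h"
  shows "\<exists>C\<ge>0. \<forall>p u. norm (h (p + u) - h p - frechet_derivative h (at p) u
    - (1 / 2) *\<^sub>R second_derivative h p u u) \<le> C * norm u ^ 3"
proof -
  have h1: "bounded_gradient 1 h"
    using h bounded_gradient_Suc_imp[of 1] by (simp add: numeral_2_eq_2)
  have lin: "linear (frechet_derivative h (at p))" for p
    using bounded_gradient_linear[OF h] .
  have linv: "linear (second_derivative h p u)" and linu: "linear (\<lambda>u. second_derivative h p u v)" for p u v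
    using bounded_bilinear_second_derivative(2)[OF h1] unfolding bilinear_def by auto
  have "\<exists>C\<ge>0. \<forall>q v. norm (frechet_derivative h (at (fst q + snd q)) v - frechet_derivative h (at (fst q)) v
      - second_derivative h (fst q) (snd q) v) \<le> C * (norm (snd q))\<^sup>2 * norm v"
  proof (rule Basis_bound_imp_bound)
    show "linear (\<lambda>v. frechet_derivative h (at (fst q + snd q)) v - frechet_derivative h (at (fst q)) v
      - second_derivative h (fst q) (snd q) v)" for q
      by (intro linear_compose_sub lin linv)
    fix b :: 'a assume b: "b \<in> Basis"
    have "bounded_gradient 1 (\<lambda>p. frechet_derivative h (at p) b)"
      using bounded_gradient_partial[of 1] h b by (simp add: numeral_2_eq_2)
    then show "\<exists>M. \<forall>q. norm (frechet_derivative h (at (fst q + snd q)) b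
      - frechet_derivative h (at (fst q)) b - second_derivative h (fst q) (snd q) b) \<le> M * (norm (snd q))\<^sup>2"
      unfolding second_derivative_Basis[OF b] using taylor_first_order by fastforce
  qed simp
  then obtain C where C: "C \<ge> 0" "\<And>p u v. norm (frechet_derivative h (at (p + u)) v
      - frechet_derivative h (at p) v - second_derivative h p u v) \<le> C * (norm u)\<^sup>2 * norm v"
    by auto
  have "norm (h (p + u) - h p - frechet_derivative h (at p) u - (1 / 2) *\<^sub>R second_derivative h p u u)
      \<le> C * norm u ^ 3" for p u
  proof -
    \<comment> \<open>\<open>\<phi> 1 - \<phi> 0\<close> is the Taylor remainder, and
      \<open>\<phi>'\<close> is the first-order remainder of the derivative for the increment s u,
      tested with u.\<close>
    define \<phi> where "\<phi> = (\<lambda>s::real. h (p + s *\<^sub>R u) - s *\<^sub>R frechet_derivative h (at p) u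
      - (s\<^sup>2 / 2) *\<^sub>R second_derivative h p u u)"
    define \<phi>' where "\<phi>' = (\<lambda>s. frechet_derivative h (at (p + s *\<^sub>R u)) u - frechet_derivative h (at p) u
      - s *\<^sub>R second_derivative h p u u)"
    have "norm (\<phi> 1 - \<phi> 0) \<le> (C * norm u ^ 3) * norm (1 - 0 :: real)"
    proof (rule differentiable_bound[of "{0..1}" \<phi> "\<lambda>s t. t *\<^sub>R \<phi>' s"])
      fix s :: real assume s: "s \<in> {0..1}"
      have "((\<lambda>s. h (p + s *\<^sub>R u)) has_derivative (\<lambda>t. frechet_derivative h (at (p + s *\<^sub>R u)) (t *\<^sub>R u)))
          (at s within {0..1})"
        by (rule has_derivative_compose[OF _ bounded_gradient_has_derivative[OF h]])
          (auto intro!: derivative_eq_intros)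
      then have 1: "((\<lambda>s. h (p + s *\<^sub>R u)) has_derivative (\<lambda>t. t *\<^sub>R frechet_derivative h (at (p + s *\<^sub>R u)) u))
          (at s within {0..1})"
        by (simp add: linear_scale[OF lin])
      have 2: "((\<lambda>s::real. s\<^sup>2 / 2) has_derivative (\<lambda>t. t * s)) (at s within {0..1})"
        by (auto intro!: derivative_eq_intros)
      show "(\<phi> has_derivative (\<lambda>t. t *\<^sub>R \<phi>' s)) (at s within {0..1})"
        unfolding \<phi>_def \<phi>'_def
        by (rule has_derivative_eq_rhs[OF has_derivative_diff[OF has_derivative_diff[OF 1
              has_derivative_scaleR_left[OF has_derivative_ident]] has_derivative_scaleR_left[OF 2]]])
          (simp add: scaleR_diff_right)
      show "onorm (\<lambda>t. t *\<^sub>R \<phi>' s) \<le> C * norm u ^ 3"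
      proof (rule onorm_le)
        fix t :: real
        have "norm (\<phi>' s) \<le> C * (norm (s *\<^sub>R u))\<^sup>2 * norm u"
          using C(2)[of p "s *\<^sub>R u" u] by (simp add: \<phi>'_def linear_scale[OF linu])
        also have "\<dots> = s\<^sup>2 * (C * norm u ^ 3)"
          by (simp add: power_mult_distrib power2_eq_square power3_eq_cube)
        also have "\<dots> \<le> C * norm u ^ 3"
          using s C(1) by (intro mult_left_le_one_le) (auto simp: power_le_one)
        finally show "norm (t *\<^sub>R \<phi>' s) \<le> C * norm u ^ 3 * norm t"
          by (simp add: mult_left_mono mult.commute)
      qed
    qed auto
    then show ?thesis
      by (simp add: \<phi>_def algebra_simps)
  qed
  with C(1) show ?thesis by blast
qed

section \<open>Regularity of the slow manifold and of its expansion\<close>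

lemma bounded_derivs_apply:
  assumes "\<And>x. linear (L x)" "\<And>b. b \<in> Basis \<Longrightarrow> bounded_derivs k (\<lambda>x. L x b)" "bounded_derivs k v"
  shows "bounded_derivs k (\<lambda>x. L x (v x))"
  unfolding linear_Basis_expansion[OF assms(1), of _ "v _"]
  using assms(2,3) by (intro bounded_derivs_sum bounded_derivs_scaleR bounded_derivs_inner_const) auto

lemma bounded_derivs_Pair_0: "bounded_derivs k v \<Longrightarrow> bounded_derivs k (\<lambda>x. (0, v x))"
  by (rule bounded_derivs_linear[OF bounded_linear_Pair[OF bounded_linear_zero bounded_linear_ident]])

lemma bounded_gradient_graph:
  assumes "bounded_gradient k \<gamma>"
  shows "bounded_gradient k (\<lambda>x. (x, \<gamma> x))"
proof (rule bounded_gradientI)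
  show "((\<lambda>x. (x, \<gamma> x)) has_derivative (\<lambda>u. (u, frechet_derivative \<gamma> (at x) u))) (at x)" for x
    by (rule has_derivative_Pair[OF has_derivative_ident bounded_gradient_has_derivative[OF assms]])
  show "bounded_derivs k (\<lambda>x. (b, frechet_derivative \<gamma> (at x) b))" if b: "b \<in> Basis" for b
    using bounded_derivs_add[OF bounded_derivs_const[of k "(b, 0)"]
        bounded_derivs_Pair_0[OF bounded_gradient_bounded_derivs[OF assms b]]] by simp
qed

lemma bounded_derivs_graph:
  assumes "bounded_derivs (Suc k) h" "bounded_gradient k \<gamma>"
  shows "bounded_derivs (Suc k) (\<lambda>x. h (x, \<gamma> x))"
  by (rule bounded_derivs_compose[OF assms(1) bounded_gradient_graph[OF assms(2)]])

lemma frechet_coercive: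
  fixes g :: "'a::euclidean_space \<times> 'b::euclidean_space \<Rightarrow> 'b"
  assumes "bounded_gradient k g"
    and "\<And>x y y'. (g (x, y) - g (x, y')) \<bullet> (y - y') \<le> - \<beta> * (norm (y - y'))\<^sup>2"
  shows "frechet_derivative g (at (x, y)) (0, u) \<bullet> u \<le> - \<beta> * (norm u)\<^sup>2"
  using dissipative_imp_coercive[OF bounded_gradient_has_derivative[OF assms(1)] assms(2)] .

text \<open>The partial derivatives of \<open>\<gamma>\<close> and both coefficients solve systems
  with the same matrix, the y-derivative of g on the graph. Bounds on that matrix form a separate
  hypothesis because for \<open>\<gamma>\<close> they become available only one order at a
  time.\<close>

lemma bounded_derivs_solve:
  fixes g :: "'a::euclidean_space \<times> 'b::euclidean_space \<Rightarrow> 'b"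
  assumes g: "bounded_gradient l g" and \<beta>: "\<beta> > 0"
    and diss: "\<And>x y y'. (g (x, y) - g (x, y')) \<bullet> (y - y') \<le> - \<beta> * (norm (y - y'))\<^sup>2"
    and a: "\<And>c. c \<in> Basis \<Longrightarrow> bounded_derivs k (\<lambda>x. frechet_derivative g (at (x, \<gamma> x)) (0, c))"
    and w: "bounded_derivs k w" and eq: "\<And>x. frechet_derivative g (at (x, \<gamma> x)) (0, v x) = w x"
  shows "bounded_derivs k v"
proof -
  have *: "(\<Sum>c\<in>Basis. (u \<bullet> c) *\<^sub>R frechet_derivative g (at (x, \<gamma> x)) (0, c)) =
      frechet_derivative g (at (x, \<gamma> x)) (0, u)" for x u
    using linear_Basis_expansion[of "\<lambda>u. frechet_derivative g (at (x, \<gamma> x)) (0, u)" u]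
      linear_compose[OF _ bounded_gradient_linear[OF g, of "(x, \<gamma> x)"], of "\<lambda>u. (0, u)"]
    by (simp add: o_def bounded_linear_Pair bounded_linear.linear bounded_linear_zero bounded_linear_ident)
  show ?thesis
  proof (rule bounded_derivs_linear_system[OF a w _ \<beta>])
    show "(\<Sum>c\<in>Basis. (v x \<bullet> c) *\<^sub>R frechet_derivative g (at (x, \<gamma> x)) (0, c)) = w x" for x
      unfolding * by (rule eq)
    show "(\<Sum>c\<in>Basis. (u \<bullet> c) *\<^sub>R frechet_derivative g (at (x, \<gamma> x)) (0, c)) \<bullet> u
        \<le> - \<beta> * (norm u)\<^sup>2" for x u
      unfolding * by (rule frechet_coercive[OF g diss])
  qed
qed

text \<open>A bootstrap: j bounded derivatives of the gradient of \<open>\<gamma>\<close> give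
  \<open>Suc j\<close> bounded derivatives of the coefficients on the graph, and solving the system
  returns \<open>Suc j\<close> for the gradient. It starts because a bound on the partial
  derivatives of g holds at every point, hence along any graph.\<close>

lemma slow_manifold_regularity:
  fixes g :: "'a::euclidean_space \<times> 'b::euclidean_space \<Rightarrow> 'b"
  assumes g: "bounded_gradient k g" and \<beta>: "\<beta> > 0"
    and diss: "\<And>x y y'. (g (x, y) - g (x, y')) \<bullet> (y - y') \<le> - \<beta> * (norm (y - y'))\<^sup>2"
    and zero: "\<And>x. g (x, \<gamma> x) = 0"
  shows "bounded_gradient k \<gamma>"
proof -
  have "\<gamma> differentiable (at x)" for x
    by (rule implicit_zero_differentiable[OF bounded_gradient_has_derivative[OF g] zero \<beta> diss])
  then have \<gamma>': "(\<gamma> has_derivative frechet_derivative \<gamma> (at x)) (at x)" for x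
    using frechet_derivative_works by blast
  have eq: "frechet_derivative g (at (x, \<gamma> x)) (0, frechet_derivative \<gamma> (at x) u) =
      - frechet_derivative g (at (x, \<gamma> x)) (u, 0)" for x u
  proof -
    have "((\<lambda>x. g (x, \<gamma> x)) has_derivative
        (\<lambda>u. frechet_derivative g (at (x, \<gamma> x)) (u, frechet_derivative \<gamma> (at x) u))) (at x)"
      by (rule has_derivative_compose[OF has_derivative_Pair[OF has_derivative_ident \<gamma>']
            bounded_gradient_has_derivative[OF g]])
    then have "(\<lambda>u. frechet_derivative g (at (x, \<gamma> x)) (u, frechet_derivative \<gamma> (at x) u)) = (\<lambda>_. 0)"
      unfolding zero using has_derivative_unique has_derivative_const by blast
    then have "frechet_derivative g (at (x, \<gamma> x)) (u, frechet_derivative \<gamma> (at x) u) = 0"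
      by (rule fun_cong)
    moreover have "frechet_derivative g (at (x, \<gamma> x)) (u, frechet_derivative \<gamma> (at x) u) =
        frechet_derivative g (at (x, \<gamma> x)) (u, 0) + frechet_derivative g (at (x, \<gamma> x)) (0, frechet_derivative \<gamma> (at x) u)"
      using linear_add[OF bounded_gradient_linear[OF g], of _ "(u, 0)" "(0, frechet_derivative \<gamma> (at x) u)"]
      by simp
    ultimately show ?thesis by (metis add.commute add_eq_0_iff)
  qed
  have step: "bounded_gradient j \<gamma>"
    if p: "\<And>b. b \<in> Basis \<Longrightarrow> bounded_derivs j (\<lambda>x. frechet_derivative g (at (x, \<gamma> x)) b)" for j
  proof (rule bounded_gradientI[OF \<gamma>'])
    fix b :: 'a assume b: "b \<in> Basis"
    show "bounded_derivs j (\<lambda>x. frechet_derivative \<gamma> (at x) b)"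
    proof (rule bounded_derivs_solve[OF g \<beta> diss _ _ eq])
      show "bounded_derivs j (\<lambda>x. - frechet_derivative g (at (x, \<gamma> x)) (b, 0))"
        using b by (intro bounded_derivs_linear[of uminus] p bounded_linear_minus bounded_linear_ident)
          (simp add: Basis_prod_def)
    qed (use p in \<open>simp add: Basis_prod_def\<close>)
  qed
  have "j \<le> k \<Longrightarrow> bounded_gradient j \<gamma>" for j
  proof (induction j)
    case 0
    show ?case
    proof (rule step)
      fix b :: "'a \<times> 'b" assume "b \<in> Basis"
      then obtain B where "\<And>p. norm (frechet_derivative g (at p) b) \<le> B"
        using bounded_derivs_imp_bounded[OF bounded_gradient_bounded_derivs[OF g]]
        unfolding bounded_derivs.simps by metis
      then show "bounded_derivs 0 (\<lambda>x. frechet_derivative g (at (x, \<gamma> x)) b)"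
        by auto
    qed
  next
    case (Suc j)
    show ?case
    proof (rule step)
      fix b :: "'a \<times> 'b" assume b: "b \<in> Basis"
      have "bounded_gradient (Suc j) g"
        by (rule bounded_gradient_mono[OF Suc.prems g])
      from bounded_derivs_graph[OF bounded_gradient_bounded_derivs[OF this b]] Suc
      show "bounded_derivs (Suc j) (\<lambda>x. frechet_derivative g (at (x, \<gamma> x)) b)"
        by simp
    qed
  qed
  then show ?thesis by simp
qed

text \<open>Only first derivatives of g and \<open>\<gamma>\<close> and f itself enter the equation,
  and along the graph all of these have two bounded derivatives.\<close>

lemma first_coefficient_regularity:
  fixes f :: "'a::euclidean_space \<times> 'b::euclidean_space \<Rightarrow> 'a"
    and g :: "'a \<times> 'b \<Rightarrow> 'b"
  assumes f: "bounded_derivs 2 f" and g: "bounded_gradient 2 g" and \<beta>: "\<beta> > 0"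
    and diss: "\<And>x y y'. (g (x, y) - g (x, y')) \<bullet> (y - y') \<le> - \<beta> * (norm (y - y'))\<^sup>2"
    and \<gamma>: "bounded_gradient 2 \<gamma>"
    and eq: "\<And>x. frechet_derivative g (at (x, \<gamma> x)) (0, \<gamma>\<^sub>1 x) = frechet_derivative \<gamma> (at x) (f (x, \<gamma> x))"
  shows "bounded_derivs 2 \<gamma>\<^sub>1"
proof -
  have \<gamma>1: "bounded_gradient 1 \<gamma>"
    using \<gamma> bounded_gradient_Suc_imp by (simp add: numeral_2_eq_2)
  note graph = bounded_derivs_graph[OF _ \<gamma>1, unfolded Suc_1]
  show ?thesis
  proof (rule bounded_derivs_solve[OF g \<beta> diss _ _ eq])
    show "bounded_derivs 2 (\<lambda>x. frechet_derivative g (at (x, \<gamma> x)) (0, c))" if "c \<in> Basis" for c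
      using that by (intro graph bounded_gradient_bounded_derivs[OF g]) (simp add: Basis_prod_def)
    show "bounded_derivs 2 (\<lambda>x. frechet_derivative \<gamma> (at x) (f (x, \<gamma> x)))"
      by (rule bounded_derivs_apply[OF bounded_gradient_linear[OF \<gamma>]
            bounded_gradient_bounded_derivs[OF \<gamma>] graph[OF f]])
  qed
qed

text \<open>Each term on the right contains a first derivative of f or
  \<open>\<gamma>\<^sub>1\<close> or a second derivative of g, which have one bounded derivative
  left. The residual consumes it through the gradient of \<open>\<gamma>\<^sub>2\<close>.\<close>

lemma second_coefficient_regularity:
  fixes f :: "'a::euclidean_space \<times> 'b::euclidean_space \<Rightarrow> 'a"
    and g :: "'a \<times> 'b \<Rightarrow> 'b"
  assumes f: "bounded_derivs 2 f" and g: "bounded_gradient 2 g" and \<beta>: "\<beta> > 0"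
    and diss: "\<And>x y y'. (g (x, y) - g (x, y')) \<bullet> (y - y') \<le> - \<beta> * (norm (y - y'))\<^sup>2"
    and \<gamma>: "bounded_gradient 2 \<gamma>" and \<gamma>\<^sub>1: "bounded_derivs 2 \<gamma>\<^sub>1"
    and eq: "\<And>x. frechet_derivative g (at (x, \<gamma> x)) (0, \<gamma>\<^sub>2 x) =
      frechet_derivative \<gamma> (at x) (frechet_derivative f (at (x, \<gamma> x)) (0, \<gamma>\<^sub>1 x))
      + frechet_derivative \<gamma>\<^sub>1 (at x) (f (x, \<gamma> x))
      - (1 / 2) *\<^sub>R second_derivative g (x, \<gamma> x) (0, \<gamma>\<^sub>1 x) (0, \<gamma>\<^sub>1 x)"
  shows "bounded_derivs 1 \<gamma>\<^sub>2"
proof -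
  have \<gamma>': "bounded_gradient 1 \<gamma>" "bounded_gradient 0 \<gamma>"
    using \<gamma> bounded_gradient_Suc_imp bounded_gradient_imp_0 by (auto simp: numeral_2_eq_2)
  note graph = bounded_derivs_graph[OF _ \<gamma>'(2), folded One_nat_def]
  have down: "bounded_derivs 1 h" if "bounded_derivs 2 h" for h :: "'c::euclidean_space \<Rightarrow> 'd::euclidean_space"
    using that bounded_derivs_Suc_imp[of 1 h] by (simp add: numeral_2_eq_2)
  have f1: "bounded_gradient 1 f"
    using f bounded_derivs_imp_gradient[of 1 f] by (simp add: numeral_2_eq_2)
  have \<gamma>\<^sub>1': "bounded_gradient 1 \<gamma>\<^sub>1"
    using \<gamma>\<^sub>1 bounded_derivs_imp_gradient[of 1 \<gamma>\<^sub>1] by (simp add: numeral_2_eq_2)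
  have g1: "bounded_gradient 1 (\<lambda>p. frechet_derivative g (at p) b)" if "b \<in> Basis" for b
    using bounded_gradient_partial[of 1 g] g that by (simp add: numeral_2_eq_2)
  have pair: "bounded_derivs 1 (\<lambda>x. (0, \<gamma>\<^sub>1 x))"
    by (rule bounded_derivs_Pair_0[OF down[OF \<gamma>\<^sub>1]])
  show ?thesis
  proof (rule bounded_derivs_solve[OF g \<beta> diss _ _ eq])
    show "bounded_derivs 1 (\<lambda>x. frechet_derivative g (at (x, \<gamma> x)) (0, c))" if "c \<in> Basis" for c
      using that by (intro graph down bounded_gradient_bounded_derivs[OF g]) (simp add: Basis_prod_def)
    have 1: "bounded_derivs 1 (\<lambda>x. frechet_derivative \<gamma> (at x) (frechet_derivative f (at (x, \<gamma> x)) (0, \<gamma>\<^sub>1 x)))"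
      by (rule bounded_derivs_apply[OF bounded_gradient_linear[OF \<gamma>'(1)] bounded_gradient_bounded_derivs[OF \<gamma>'(1)]
            bounded_derivs_apply[OF bounded_gradient_linear[OF f1] graph[OF bounded_gradient_bounded_derivs[OF f1]] pair]])
    have 2: "bounded_derivs 1 (\<lambda>x. frechet_derivative \<gamma>\<^sub>1 (at x) (f (x, \<gamma> x)))"
      by (rule bounded_derivs_apply[OF bounded_gradient_linear[OF \<gamma>\<^sub>1'] bounded_gradient_bounded_derivs[OF \<gamma>\<^sub>1']
            graph[OF down[OF f]]])
    have 3: "bounded_derivs 1 (\<lambda>x. second_derivative g (x, \<gamma> x) (0, \<gamma>\<^sub>1 x) (0, \<gamma>\<^sub>1 x))"
      unfolding second_derivative_def
      by (intro bounded_derivs_sum bounded_derivs_scaleR bounded_derivs_inner_const pair finite_Basis)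
        (rule bounded_derivs_apply[OF bounded_gradient_linear[OF g1]
            graph[OF bounded_gradient_bounded_derivs[OF g1]] pair])
    show "bounded_derivs 1 (\<lambda>x.
      frechet_derivative \<gamma> (at x) (frechet_derivative f (at (x, \<gamma> x)) (0, \<gamma>\<^sub>1 x))
      + frechet_derivative \<gamma>\<^sub>1 (at x) (f (x, \<gamma> x))
      - (1 / 2) *\<^sub>R second_derivative g (x, \<gamma> x) (0, \<gamma>\<^sub>1 x) (0, \<gamma>\<^sub>1 x))"
      using bounded_derivs_add[OF bounded_derivs_add[OF 1 2]
          bounded_derivs_scaleR[OF bounded_derivs_const[of 1 "- (1 / 2)"] 3]] by simp
  qed
qed

section \<open>The residual of the expansion\<close>

text \<open>Expand around p = (x, \<gamma> x), where g vanishes. \<open>eq1\<close> and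
  \<open>eq2\<close> cancel the orders \<epsilon> and \<epsilon>^2, and every remaining term has a
  factor \<epsilon>^3 with a coefficient bounded uniformly in x.\<close>

lemma invariance_residual:
  fixes f :: "'a::euclidean_space \<times> 'b::euclidean_space \<Rightarrow> 'a"
    and g :: "'a \<times> 'b \<Rightarrow> 'b"
  assumes f: "bounded_derivs 2 f" and g: "bounded_gradient 2 g"
    and zero: "\<And>x. g (x, \<gamma> x) = 0"
    and \<gamma>: "bounded_gradient 0 \<gamma>" and \<gamma>\<^sub>1: "bounded_derivs 1 \<gamma>\<^sub>1" and \<gamma>\<^sub>2: "bounded_derivs 1 \<gamma>\<^sub>2"
    and eq1: "\<And>x. frechet_derivative g (at (x, \<gamma> x)) (0, \<gamma>\<^sub>1 x) = frechet_derivative \<gamma> (at x) (f (x, \<gamma> x))"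
    and eq2: "\<And>x. frechet_derivative g (at (x, \<gamma> x)) (0, \<gamma>\<^sub>2 x) =
      frechet_derivative \<gamma> (at x) (frechet_derivative f (at (x, \<gamma> x)) (0, \<gamma>\<^sub>1 x))
      + frechet_derivative \<gamma>\<^sub>1 (at x) (f (x, \<gamma> x))
      - (1 / 2) *\<^sub>R second_derivative g (x, \<gamma> x) (0, \<gamma>\<^sub>1 x) (0, \<gamma>\<^sub>1 x)"
  shows "\<exists>C\<ge>0. \<forall>x \<epsilon>. 0 < \<epsilon> \<longrightarrow> \<epsilon> \<le> 1 \<longrightarrow>
    (let y = \<gamma> x + \<epsilon> *\<^sub>R \<gamma>\<^sub>1 x + \<epsilon>\<^sup>2 *\<^sub>R \<gamma>\<^sub>2 x; w = f (x, y) in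
      norm (g (x, y) - \<epsilon> *\<^sub>R (frechet_derivative \<gamma> (at x) w + \<epsilon> *\<^sub>R frechet_derivative \<gamma>\<^sub>1 (at x) w
        + \<epsilon>\<^sup>2 *\<^sub>R frechet_derivative \<gamma>\<^sub>2 (at x) w)) \<le> C * \<epsilon> ^ 3)"
proof -
  have f1: "bounded_gradient 1 f" "bounded_derivs 0 f"
    using f bounded_derivs_imp_gradient[of 1 f] bounded_derivs_imp_bounded[of 2 f]
    by (auto simp: numeral_2_eq_2)
  have g1: "bounded_gradient 1 g"
    using g bounded_gradient_Suc_imp[of 1 g] by (simp add: numeral_2_eq_2)
  have \<gamma>': "bounded_gradient 0 \<gamma>\<^sub>1" "bounded_derivs 0 \<gamma>\<^sub>1" "bounded_gradient 0 \<gamma>\<^sub>2" "bounded_derivs 0 \<gamma>\<^sub>2"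
    using \<gamma>\<^sub>1 \<gamma>\<^sub>2 unfolding One_nat_def bounded_derivs_Suc_iff by auto
  note lin\<gamma> = bounded_gradient_linear[OF \<gamma>] and lin\<gamma>1 = bounded_gradient_linear[OF \<gamma>'(1)]
    and lin\<gamma>2 = bounded_gradient_linear[OF \<gamma>'(3)] and linf = bounded_gradient_linear[OF f1(1)]
    and ling = bounded_gradient_linear[OF g]
  obtain B1 where B1: "\<And>x. norm (\<gamma>\<^sub>1 x) \<le> B1" using \<gamma>'(2) by auto
  obtain B2 where B2: "\<And>x. norm (\<gamma>\<^sub>2 x) \<le> B2" using \<gamma>'(4) by auto
  obtain Bf where Bf: "\<And>p. norm (f p) \<le> Bf" using f1(2) unfolding bounded_derivs.simps by blast
  have nn: "0 \<le> B1" "0 \<le> B2" "0 \<le> Bf"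
    using B1 B2 Bf norm_ge_zero order_trans by blast+
  obtain M where M: "M \<ge> 0" "\<And>x u. norm (frechet_derivative \<gamma> (at x) u) \<le> M * norm u"
    using bounded_gradient_bound[OF \<gamma>] by blast
  obtain M1 where M1: "M1 \<ge> 0" "\<And>x u. norm (frechet_derivative \<gamma>\<^sub>1 (at x) u) \<le> M1 * norm u"
    using bounded_gradient_bound[OF \<gamma>'(1)] by blast
  obtain M2 where M2: "M2 \<ge> 0" "\<And>x u. norm (frechet_derivative \<gamma>\<^sub>2 (at x) u) \<le> M2 * norm u"
    using bounded_gradient_bound[OF \<gamma>'(3)] by blast
  obtain Lf where Lf: "Lf \<ge> 0" "\<And>p u. norm (frechet_derivative f (at p) u) \<le> Lf * norm u"
    using bounded_gradient_bound[OF bounded_gradient_imp_0[OF f1(1)]] by blast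
  obtain Lf' where Lf': "Lf' \<ge> 0" "\<And>p u. norm (f (p + u) - f p) \<le> Lf' * norm u"
    using bounded_gradient_Lipschitz[OF bounded_gradient_imp_0[OF f1(1)]] by blast
  obtain Tf where Tf: "Tf \<ge> 0" "\<And>p u. norm (f (p + u) - f p - frechet_derivative f (at p) u) \<le> Tf * (norm u)\<^sup>2"
    using taylor_first_order[OF f1(1)] by blast
  obtain Tg where Tg: "Tg \<ge> 0" "\<And>p u. norm (g (p + u) - g p - frechet_derivative g (at p) u
      - (1 / 2) *\<^sub>R second_derivative g p u u) \<le> Tg * norm u ^ 3"
    using taylor_second_order[OF g] by blast
  obtain S where S: "S \<ge> 0" "\<And>p u v. norm (second_derivative g p u v) \<le> S * norm u * norm v"
    using bounded_bilinear_second_derivative(1)[OF g1] by blast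
  note bil = bounded_bilinear_second_derivative(2)[OF g1]
  \<comment> \<open>As \<epsilon> \<le> 1, the increment \<open>\<eta>\<close> below has norm at
    most \<epsilon> D. The five terms of \<open>C\<close> belong, in order, to the Taylor remainder
    of g, the higher bilinear terms, and f under the gradients of \<open>\<gamma>\<close>,
    \<open>\<gamma>\<^sub>1\<close> and \<open>\<gamma>\<^sub>2\<close>.\<close>
  define D where "D = B1 + B2"
  define C where "C = Tg * D ^ 3 + S * (B1 * B2 + B2 * B1 + B2 * B2) + M * (Lf * B2 + Tf * D\<^sup>2)
    + M1 * (Lf' * D) + M2 * Bf"
  have "C \<ge> 0"
    using nn M M1 M2 Lf Lf' Tf Tg S by (simp add: C_def D_def)
  moreover have "norm (g (x, y) - \<epsilon> *\<^sub>R (frechet_derivative \<gamma> (at x) w + \<epsilon> *\<^sub>R frechet_derivative \<gamma>\<^sub>1 (at x) w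
        + \<epsilon>\<^sup>2 *\<^sub>R frechet_derivative \<gamma>\<^sub>2 (at x) w)) \<le> C * \<epsilon> ^ 3"
    if \<epsilon>: "0 < \<epsilon>" "\<epsilon> \<le> 1" and y: "y = \<gamma> x + \<epsilon> *\<^sub>R \<gamma>\<^sub>1 x + \<epsilon>\<^sup>2 *\<^sub>R \<gamma>\<^sub>2 x" and w: "w = f (x, y)"
    for x y w and \<epsilon> :: real
  proof -
    define p where "p = (x, \<gamma> x)"
    define h1 h2 where h: "h1 = (0::'a, \<gamma>\<^sub>1 x)" "h2 = (0::'a, \<gamma>\<^sub>2 x)"
    define \<eta> where "\<eta> = \<epsilon> *\<^sub>R h1 + \<epsilon>\<^sup>2 *\<^sub>R h2"
    have py: "(x, y) = p + \<eta>" by (simp add: y p_def \<eta>_def h add.assoc)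
    have nh: "norm h1 \<le> B1" "norm h2 \<le> B2" using B1 B2 by (simp_all add: h)
    have "norm \<eta> \<le> \<epsilon> * norm h1 + \<epsilon>\<^sup>2 * norm h2"
      unfolding \<eta>_def by (rule norm_triangle_le) (use \<epsilon> in simp)
    also have "\<dots> \<le> \<epsilon> * B1 + \<epsilon> * B2"
      using nh nn \<epsilon> by (intro add_mono mult_mono) (auto simp: power2_eq_square mult_left_le)
    finally have n\<eta>: "norm \<eta> \<le> \<epsilon> * D" by (simp add: D_def algebra_simps)
    define rg where "rg = g (p + \<eta>) - g p - frechet_derivative g (at p) \<eta> - (1 / 2) *\<^sub>R second_derivative g p \<eta> \<eta>"
    \<comment> \<open>The quadratic term without its part of order \<epsilon>^2, divided by
      \<epsilon>^3: the mixed terms have order \<epsilon>^3 and the last one \<epsilon>^4, whence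
      the \<epsilon> left inside.\<close>
    define rs where "rs = second_derivative g p h1 h2 + second_derivative g p h2 h1
      + \<epsilon> *\<^sub>R second_derivative g p h2 h2"
    \<comment> \<open>The gradients of \<open>\<gamma>\<close>, \<open>\<gamma>\<^sub>1\<close>,
      \<open>\<gamma>\<^sub>2\<close> carry \<epsilon>, \<epsilon>^2, \<epsilon>^3. So f is needed
      up to \<epsilon>^2 under the first (\<open>rf\<close>), up to \<epsilon> under the second
      (\<open>n_df\<close>), and only as a bound under the third.\<close>
    define rf where "rf = w - f p - \<epsilon> *\<^sub>R frechet_derivative f (at p) h1"
    have n_rg: "norm rg \<le> \<epsilon> ^ 3 * (Tg * D ^ 3)"
    proof -
      have "norm rg \<le> Tg * norm \<eta> ^ 3" unfolding rg_def by (rule Tg(2))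
      also have "\<dots> \<le> Tg * (\<epsilon> * D) ^ 3" using n\<eta> Tg(1) by (intro mult_left_mono power_mono) auto
      finally show ?thesis by (simp add: power_mult_distrib mult_ac)
    qed
    \<comment> \<open>The generous factor 2 matches the factor 1/2 of the quadratic Taylor
      term.\<close>
    have n_rs: "norm rs \<le> 2 * (S * (B1 * B2 + B2 * B1 + B2 * B2))"
    proof -
      have a: "norm (second_derivative g p u v) \<le> S * (b * c)" if "norm u \<le> b" "norm v \<le> c" for u v b c
        using order_trans[OF S(2)[of p u v]] that S(1) order_trans[OF norm_ge_zero that(1)]
        by (simp add: mult.assoc mult_left_mono mult_mono)
      have "norm (\<epsilon> *\<^sub>R second_derivative g p h2 h2) \<le> norm (second_derivative g p h2 h2)"
        using \<epsilon> by (simp add: mult_left_le_one_le)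
      also note a[OF nh(2) nh(2)]
      finally have "norm rs \<le> S * (B1 * B2) + S * (B2 * B1) + S * (B2 * B2)"
        unfolding rs_def by (intro norm_triangle_mono a nh)
      moreover have "0 \<le> S * (B1 * B2 + B2 * B1 + B2 * B2)" using nn S(1) by simp
      ultimately show ?thesis unfolding distrib_left by linarith
    qed
    have n_rf: "norm rf \<le> \<epsilon>\<^sup>2 * (Lf * B2 + Tf * D\<^sup>2)"
    proof -
      have "rf = \<epsilon>\<^sup>2 *\<^sub>R frechet_derivative f (at p) h2 + (f (p + \<eta>) - f p - frechet_derivative f (at p) \<eta>)"
        by (simp add: rf_def w py \<eta>_def linear_add[OF linf] linear_scale[OF linf])
      also have "norm \<dots> \<le> \<epsilon>\<^sup>2 * (Lf * B2) + Tf * (\<epsilon> * D)\<^sup>2"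
      proof (rule norm_triangle_mono)
        show "norm (\<epsilon>\<^sup>2 *\<^sub>R frechet_derivative f (at p) h2) \<le> \<epsilon>\<^sup>2 * (Lf * B2)"
          using order_trans[OF Lf(2)[of p h2] mult_left_mono[OF nh(2) Lf(1)]] by (simp add: mult_left_mono)
        show "norm (f (p + \<eta>) - f p - frechet_derivative f (at p) \<eta>) \<le> Tf * (\<epsilon> * D)\<^sup>2"
          using n\<eta> Tf(1) by (intro order_trans[OF Tf(2)] mult_left_mono power_mono) auto
      qed
      finally show ?thesis by (simp add: power_mult_distrib algebra_simps)
    qed
    have n_df: "norm (w - f p) \<le> \<epsilon> * (Lf' * D)"
      using order_trans[OF Lf'(2)[of p \<eta>] mult_left_mono[OF n\<eta> Lf'(1)]] by (simp add: w py mult_ac)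
    have expand_g: "g (x, y) = \<epsilon> *\<^sub>R frechet_derivative g (at p) h1 + \<epsilon>\<^sup>2 *\<^sub>R frechet_derivative g (at p) h2
        + (1 / 2) *\<^sub>R (\<epsilon>\<^sup>2 *\<^sub>R second_derivative g p h1 h1 + \<epsilon> ^ 3 *\<^sub>R rs) + rg"
    proof -
      have "g (x, y) = frechet_derivative g (at p) \<eta> + (1 / 2) *\<^sub>R second_derivative g p \<eta> \<eta> + rg"
        by (simp add: rg_def py) (simp add: p_def zero)
      moreover have "frechet_derivative g (at p) \<eta>
          = \<epsilon> *\<^sub>R frechet_derivative g (at p) h1 + \<epsilon>\<^sup>2 *\<^sub>R frechet_derivative g (at p) h2"
        by (simp add: \<eta>_def linear_add[OF ling] linear_scale[OF ling])
      moreover have "second_derivative g p \<eta> \<eta> = \<epsilon>\<^sup>2 *\<^sub>R second_derivative g p h1 h1 + \<epsilon> ^ 3 *\<^sub>R rs"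
        by (simp add: \<eta>_def rs_def bilinear_ladd[OF bil] bilinear_radd[OF bil] bilinear_lmul[OF bil]
            bilinear_rmul[OF bil] scaleR_add_right power2_eq_square power3_eq_cube mult.assoc)
      ultimately show ?thesis by simp
    qed
    have e1: "frechet_derivative g (at p) h1 = frechet_derivative \<gamma> (at x) (f p)"
      using eq1 by (simp add: p_def h)
    have e2: "frechet_derivative g (at p) h2 = frechet_derivative \<gamma> (at x) (frechet_derivative f (at p) h1)
        + frechet_derivative \<gamma>\<^sub>1 (at x) (f p) - (1 / 2) *\<^sub>R second_derivative g p h1 h1"
      using eq2 by (simp add: p_def h)
    have e3: "frechet_derivative \<gamma> (at x) w = frechet_derivative \<gamma> (at x) (f p)
        + \<epsilon> *\<^sub>R frechet_derivative \<gamma> (at x) (frechet_derivative f (at p) h1) + frechet_derivative \<gamma> (at x) rf"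
    proof -
      have "w = f p + \<epsilon> *\<^sub>R frechet_derivative f (at p) h1 + rf" by (simp add: rf_def)
      then show ?thesis by (metis linear_add[OF lin\<gamma>] linear_scale[OF lin\<gamma>])
    qed
    have e4: "frechet_derivative \<gamma>\<^sub>1 (at x) w = frechet_derivative \<gamma>\<^sub>1 (at x) (f p) + frechet_derivative \<gamma>\<^sub>1 (at x) (w - f p)"
      by (simp add: linear_diff[OF lin\<gamma>1])
    \<comment> \<open>Here the orders cancel; in particular the -1/2 D^2 g term in the equation for
      \<open>\<gamma>\<^sub>2\<close> removes the quadratic Taylor term of order
      \<epsilon>^2.\<close>
    have "g (x, y) - \<epsilon> *\<^sub>R (frechet_derivative \<gamma> (at x) w + \<epsilon> *\<^sub>R frechet_derivative \<gamma>\<^sub>1 (at x) w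
        + \<epsilon>\<^sup>2 *\<^sub>R frechet_derivative \<gamma>\<^sub>2 (at x) w)
      = rg + (\<epsilon> ^ 3 / 2) *\<^sub>R rs - \<epsilon> *\<^sub>R frechet_derivative \<gamma> (at x) rf
        - \<epsilon>\<^sup>2 *\<^sub>R frechet_derivative \<gamma>\<^sub>1 (at x) (w - f p) - \<epsilon> ^ 3 *\<^sub>R frechet_derivative \<gamma>\<^sub>2 (at x) w"
      unfolding expand_g e1 e2 e3 e4
      by (simp add: scaleR_add_right scaleR_diff_right power2_eq_square power3_eq_cube mult.assoc)
    also have "norm \<dots> \<le> \<epsilon> ^ 3 * (Tg * D ^ 3) + \<epsilon> ^ 3 * (S * (B1 * B2 + B2 * B1 + B2 * B2))
        + \<epsilon> ^ 3 * (M * (Lf * B2 + Tf * D\<^sup>2)) + \<epsilon> ^ 3 * (M1 * (Lf' * D)) + \<epsilon> ^ 3 * (M2 * Bf)"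
    proof (intro norm_triangle_le_diff add_mono norm_triangle_mono n_rg)
      show "norm ((\<epsilon> ^ 3 / 2) *\<^sub>R rs) \<le> \<epsilon> ^ 3 * (S * (B1 * B2 + B2 * B1 + B2 * B2))"
        using mult_left_mono[OF n_rs, of "\<epsilon> ^ 3 / 2"] \<epsilon> by simp
      have "norm (\<epsilon> *\<^sub>R frechet_derivative \<gamma> (at x) rf) \<le> \<epsilon> * (M * (\<epsilon>\<^sup>2 * (Lf * B2 + Tf * D\<^sup>2)))"
        using order_trans[OF M(2)[of x rf] mult_left_mono[OF n_rf M(1)]] \<epsilon> by simp
      then show "norm (\<epsilon> *\<^sub>R frechet_derivative \<gamma> (at x) rf) \<le> \<epsilon> ^ 3 * (M * (Lf * B2 + Tf * D\<^sup>2))"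
        by (simp add: power3_eq_cube power2_eq_square mult_ac)
      have "norm (\<epsilon>\<^sup>2 *\<^sub>R frechet_derivative \<gamma>\<^sub>1 (at x) (w - f p)) \<le> \<epsilon>\<^sup>2 * (M1 * (\<epsilon> * (Lf' * D)))"
        using order_trans[OF M1(2)[of x "w - f p"] mult_left_mono[OF n_df M1(1)]] \<epsilon> by simp
      then show "norm (\<epsilon>\<^sup>2 *\<^sub>R frechet_derivative \<gamma>\<^sub>1 (at x) (w - f p)) \<le> \<epsilon> ^ 3 * (M1 * (Lf' * D))"
        by (simp add: power3_eq_cube power2_eq_square mult_ac)
      show "norm (\<epsilon> ^ 3 *\<^sub>R frechet_derivative \<gamma>\<^sub>2 (at x) w) \<le> \<epsilon> ^ 3 * (M2 * Bf)"
        using order_trans[OF M2(2)[of x w] mult_left_mono[OF Bf[of "(x, y)"] M2(1), folded w]] \<epsilon> by simp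
    qed
    also have "\<dots> = C * \<epsilon> ^ 3" by (simp add: C_def algebra_simps)
    finally show ?thesis .
  qed
  ultimately show ?thesis unfolding Let_def by blast
qed

section \<open>Attraction to the approximate slow manifold\<close>

text \<open>With the integrating factor exp (a t), the function \<open>v\<close> is nonincreasing.
  The sign of D is used at the end, to drop - D exp (- a t).\<close>

lemma linear_differential_inequality:
  fixes u u' :: "real \<Rightarrow> real"
  assumes u: "\<And>t. t \<ge> 0 \<Longrightarrow> (u has_real_derivative u' t) (at t within {0..})"
    and ineq: "\<And>t. t \<ge> 0 \<Longrightarrow> u' t \<le> a * (D - u t)"
    and D: "D \<ge> 0" and t: "t \<ge> 0"
  shows "u t \<le> D + exp (- a * t) * u 0"
proof -
  define v where "v = (\<lambda>t. exp (a * t) * (u t - D))"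
  define v' where "v' = (\<lambda>t. exp (a * t) * (u' t - a * (D - u t)))"
  have v: "(v has_real_derivative v' s) (at s within {0..})" if "s \<ge> 0" for s
  proof -
    have "((\<lambda>t. exp (a * t)) has_real_derivative exp (a * s) * a) (at s within {0..})"
      by (auto intro!: derivative_eq_intros)
    from DERIV_mult[OF this DERIV_diff[OF u[OF that] DERIV_const[of D]]]
    show ?thesis
      unfolding v_def v'_def by (simp add: algebra_simps)
  qed
  have "v t \<le> v 0"
  proof (rule DERIV_nonpos_imp_decreasing_open[OF t])
    show "continuous_on {0..t} v"
      by (rule DERIV_continuous_on, rule DERIV_subset[OF v]) auto
    fix s assume s: "0 < s" "s < t"
    then have "(v has_real_derivative v' s) (at s)"
      using v[of s] at_within_interior[of s "{0..}"] by (simp add: interior_Ici[of "-1"])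
    moreover have "v' s \<le> 0"
      using ineq[of s] s by (simp add: v'_def mult_le_0_iff)
    ultimately show "\<exists>y. (v has_real_derivative y) (at s) \<and> y \<le> 0" by blast
  qed
  then have "exp (- a * t) * v t \<le> exp (- a * t) * (u 0 - D)"
    by (simp add: v_def)
  then have "u t - D \<le> exp (- a * t) * (u 0 - D)"
    by (simp add: v_def mult.assoc[symmetric] exp_add[symmetric])
  also have "\<dots> \<le> exp (- a * t) * u 0"
    using D by simp
  finally show ?thesis by simp
qed

text \<open>Dissipativity contributes - \<beta> |z|^2 to \<epsilon> times the inner product of z and
  z'. A quarter of \<beta> absorbs the change of f between y and \<Gamma>, once \<epsilon> is small,
  and another quarter the residual; the remaining half, doubled by differentiating the square, is
  the rate \<beta>/\<epsilon>.\<close>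

lemma approximate_slow_manifold_attracts:
  fixes f :: "'a::euclidean_space \<times> 'b::euclidean_space \<Rightarrow> 'a"
    and g :: "'a \<times> 'b \<Rightarrow> 'b"
  assumes f: "bounded_derivs 2 f" and g: "bounded_gradient 2 g" and \<beta>: "\<beta> > 0"
    and diss: "\<And>x y y'. (g (x, y) - g (x, y')) \<bullet> (y - y') \<le> - \<beta> * (norm (y - y'))\<^sup>2"
    and zero: "\<And>x. g (x, \<gamma> x) = 0"
    and \<gamma>: "bounded_gradient 0 \<gamma>" and \<gamma>\<^sub>1: "bounded_derivs 1 \<gamma>\<^sub>1" and \<gamma>\<^sub>2: "bounded_derivs 1 \<gamma>\<^sub>2"
    and eq1: "\<And>x. frechet_derivative g (at (x, \<gamma> x)) (0, \<gamma>\<^sub>1 x) = frechet_derivative \<gamma> (at x) (f (x, \<gamma> x))"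
    and eq2: "\<And>x. frechet_derivative g (at (x, \<gamma> x)) (0, \<gamma>\<^sub>2 x) =
      frechet_derivative \<gamma> (at x) (frechet_derivative f (at (x, \<gamma> x)) (0, \<gamma>\<^sub>1 x))
      + frechet_derivative \<gamma>\<^sub>1 (at x) (f (x, \<gamma> x))
      - (1 / 2) *\<^sub>R second_derivative g (x, \<gamma> x) (0, \<gamma>\<^sub>1 x) (0, \<gamma>\<^sub>1 x)"
  shows "\<exists>C>0. \<forall>\<^sub>F \<epsilon> in at_right 0. \<forall>x y z.
    (\<forall>t\<ge>0. (x has_vector_derivative f (x t, y t)) (at t within {0..}) \<and>
      (y has_vector_derivative (1 / \<epsilon>) *\<^sub>R g (x t, y t)) (at t within {0..})) \<longrightarrow>
    (\<forall>t. z t = y t - (\<gamma> (x t) + \<epsilon> *\<^sub>R \<gamma>\<^sub>1 (x t) + \<epsilon>\<^sup>2 *\<^sub>R \<gamma>\<^sub>2 (x t))) \<longrightarrow>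
    (\<forall>t\<ge>0. (norm (z t))\<^sup>2 \<le> C * \<epsilon> ^ 6 + exp (- (\<beta> / \<epsilon>) * t) * (norm (z 0))\<^sup>2)"
proof -
  have f0: "bounded_gradient 0 f"
    using f bounded_derivs_imp_gradient[of 1 f] bounded_gradient_imp_0 by (auto simp: numeral_2_eq_2)
  have \<gamma>': "bounded_gradient 0 \<gamma>\<^sub>1" "bounded_gradient 0 \<gamma>\<^sub>2"
    using \<gamma>\<^sub>1 \<gamma>\<^sub>2 unfolding One_nat_def bounded_derivs_Suc_iff by auto
  define \<Gamma>' where "\<Gamma>' = (\<lambda>\<epsilon> x w. frechet_derivative \<gamma> (at x) w + \<epsilon> *\<^sub>R frechet_derivative \<gamma>\<^sub>1 (at x) w
        + \<epsilon>\<^sup>2 *\<^sub>R frechet_derivative \<gamma>\<^sub>2 (at x) w)"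
  define \<Gamma> where "\<Gamma> = (\<lambda>\<epsilon> x. \<gamma> x + \<epsilon> *\<^sub>R \<gamma>\<^sub>1 x + \<epsilon>\<^sup>2 *\<^sub>R \<gamma>\<^sub>2 x)"
  have \<Gamma>: "(\<Gamma> \<epsilon> has_derivative \<Gamma>' \<epsilon> x) (at x)" for \<epsilon> x
    unfolding \<Gamma>_def \<Gamma>'_def
    by (intro has_derivative_add has_derivative_scaleR_right bounded_gradient_has_derivative[OF \<gamma>]
        bounded_gradient_has_derivative[OF \<gamma>'(1)] bounded_gradient_has_derivative[OF \<gamma>'(2)])
  obtain R where R: "R \<ge> 0" "\<And>x \<epsilon>. 0 < \<epsilon> \<Longrightarrow> \<epsilon> \<le> 1 \<Longrightarrow>
      norm (g (x, \<Gamma> \<epsilon> x) - \<epsilon> *\<^sub>R \<Gamma>' \<epsilon> x (f (x, \<Gamma> \<epsilon> x))) \<le> R * \<epsilon> ^ 3"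
    using invariance_residual[OF f g zero \<gamma> \<gamma>\<^sub>1 \<gamma>\<^sub>2 eq1 eq2] unfolding Let_def \<Gamma>_def \<Gamma>'_def by blast
  obtain L where L: "L \<ge> 0" "\<And>p u. norm (f (p + u) - f p) \<le> L * norm u"
    using bounded_gradient_Lipschitz[OF f0] by blast
  obtain M0 where M0: "M0 \<ge> 0" "\<And>x u. norm (frechet_derivative \<gamma> (at x) u) \<le> M0 * norm u"
    using bounded_gradient_bound[OF \<gamma>] by blast
  obtain M1 where M1: "M1 \<ge> 0" "\<And>x u. norm (frechet_derivative \<gamma>\<^sub>1 (at x) u) \<le> M1 * norm u"
    using bounded_gradient_bound[OF \<gamma>'(1)] by blast
  obtain M2 where M2: "M2 \<ge> 0" "\<And>x u. norm (frechet_derivative \<gamma>\<^sub>2 (at x) u) \<le> M2 * norm u"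
    using bounded_gradient_bound[OF \<gamma>'(2)] by blast
  define M where "M = M0 + M1 + M2"
  have M: "M \<ge> 0" using M0 M1 M2 by (simp add: M_def)
  have \<Gamma>'_bound: "norm (\<Gamma>' \<epsilon> x w) \<le> M * norm w" if \<epsilon>: "0 < \<epsilon>" "\<epsilon> \<le> 1" for \<epsilon> x w
  proof -
    have "norm (\<epsilon> *\<^sub>R frechet_derivative \<gamma>\<^sub>1 (at x) w) \<le> M1 * norm w"
      using mult_left_le_one_le[of "norm (frechet_derivative \<gamma>\<^sub>1 (at x) w)" \<epsilon>] \<epsilon> M1(2)[of x w] by simp
    moreover have "norm (\<epsilon>\<^sup>2 *\<^sub>R frechet_derivative \<gamma>\<^sub>2 (at x) w) \<le> M2 * norm w"
      using mult_left_le_one_le[of "norm (frechet_derivative \<gamma>\<^sub>2 (at x) w)" "\<epsilon>\<^sup>2"] \<epsilon> M2(2)[of x w]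
      by (simp add: power_le_one)
    ultimately have "norm (\<Gamma>' \<epsilon> x w) \<le> M0 * norm w + M1 * norm w + M2 * norm w"
      unfolding \<Gamma>'_def using M0(2) by (intro norm_triangle_mono)
    then show ?thesis by (simp add: M_def algebra_simps)
  qed
  \<comment> \<open>The quotient comes from Young's inequality; adding 1 keeps C positive if R =
    0.\<close>
  define C where "C = 2 * R\<^sup>2 / \<beta>\<^sup>2 + 1"
  \<comment> \<open>The bound 1 controls the powers of \<epsilon> in \<Gamma>' and the residual, and
    the other gives \<epsilon> M L \<le> \<beta>/4; the + 1 in it guards against M L = 0.\<close>
  define \<epsilon>0 where "\<epsilon>0 = min 1 (\<beta> / (4 * (M * L + 1)))"
  have \<epsilon>0: "\<epsilon>0 > 0" using \<beta> M L by (simp add: \<epsilon>0_def add_nonneg_pos)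
  have main: "\<forall>t\<ge>0. (norm (z t))\<^sup>2 \<le> C * \<epsilon> ^ 6 + exp (- (\<beta> / \<epsilon>) * t) * (norm (z 0))\<^sup>2"
    if \<epsilon>: "0 < \<epsilon>" "\<epsilon> < \<epsilon>0"
      and sol: "\<And>t. t \<ge> 0 \<Longrightarrow> (x has_vector_derivative f (x t, y t)) (at t within {0..})"
        "\<And>t. t \<ge> 0 \<Longrightarrow> (y has_vector_derivative (1 / \<epsilon>) *\<^sub>R g (x t, y t)) (at t within {0..})"
      and z: "\<And>t. z t = y t - \<Gamma> \<epsilon> (x t)"
    for \<epsilon> and x :: "real \<Rightarrow> 'a" and y z :: "real \<Rightarrow> 'b"
  proof (intro allI impI)
    fix t :: real assume t: "t \<ge> 0"
    have \<epsilon>1: "\<epsilon> \<le> 1" and small: "\<epsilon> * (M * L) \<le> \<beta> / 4"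
    proof -
      show "\<epsilon> \<le> 1" using \<epsilon> by (simp add: \<epsilon>0_def)
      have "\<epsilon> < \<beta> / (4 * (M * L + 1))" using \<epsilon> by (simp add: \<epsilon>0_def)
      moreover have "0 < M * L + 1" using M L(1) by (simp add: add_nonneg_pos)
      ultimately have "\<epsilon> * (M * L + 1) < \<beta> / 4" by (simp add: field_simps)
      then show "\<epsilon> * (M * L) \<le> \<beta> / 4" using \<epsilon> by (simp add: distrib_left)
    qed
    define z' where "z' = (\<lambda>s. (1 / \<epsilon>) *\<^sub>R g (x s, y s) - \<Gamma>' \<epsilon> (x s) (f (x s, y s)))"
    have dz: "(z has_vector_derivative z' s) (at s within {0..})" if s: "s \<ge> 0" for s
    proof -
      have "((\<Gamma> \<epsilon> \<circ> x) has_vector_derivative \<Gamma>' \<epsilon> (x s) (f (x s, y s))) (at s within {0..})"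
        by (rule vector_derivative_diff_chain_within[OF sol(1)[OF s] has_derivative_at_withinI[OF \<Gamma>]])
      from has_vector_derivative_diff[OF sol(2)[OF s] this]
      show ?thesis unfolding z'_def by (simp add: z[abs_def])
    qed
    have energy: "2 * (z s \<bullet> z' s) \<le> (\<beta> / \<epsilon>) * (2 * R\<^sup>2 / \<beta>\<^sup>2 * \<epsilon> ^ 6 - (norm (z s))\<^sup>2)" for s
    proof -
      define X Y Y0 where "X = x s" and "Y = y s" and "Y0 = \<Gamma> \<epsilon> (x s)"
      have Z: "z s = Y - Y0" by (simp add: z Y_def Y0_def)
      have lin: "linear (\<Gamma>' \<epsilon> X)" using has_derivative_linear[OF \<Gamma>] .
      \<comment> \<open>The point \<open>Y0\<close> of the approximate manifold is inserted into
        both g and f, which separates contraction towards it, its residual, and the variation of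
        f.\<close>
      have split: "\<epsilon> *\<^sub>R z' s = (g (X, Y) - g (X, Y0)) + (g (X, Y0) - \<epsilon> *\<^sub>R \<Gamma>' \<epsilon> X (f (X, Y0)))
          - \<epsilon> *\<^sub>R \<Gamma>' \<epsilon> X (f (X, Y) - f (X, Y0))"
        using \<epsilon> by (simp add: z'_def X_def[symmetric] Y_def[symmetric] linear_diff[OF lin] scaleR_diff_right)
      have "\<epsilon> * (z s \<bullet> z' s) = (\<epsilon> *\<^sub>R z' s) \<bullet> z s"
        by (simp add: inner_commute)
      also have "\<dots> = (g (X, Y) - g (X, Y0)) \<bullet> z s
          + (g (X, Y0) - \<epsilon> *\<^sub>R \<Gamma>' \<epsilon> X (f (X, Y0))) \<bullet> z s
          + (- (\<epsilon> *\<^sub>R \<Gamma>' \<epsilon> X (f (X, Y) - f (X, Y0)))) \<bullet> z s"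
        unfolding split by (simp add: inner_add_left inner_diff_left)
      also have "\<dots> \<le> - \<beta> * (norm (z s))\<^sup>2 + R * \<epsilon> ^ 3 * norm (z s) + \<epsilon> * (M * L) * (norm (z s))\<^sup>2"
      proof (intro add_mono)
        show "(g (X, Y) - g (X, Y0)) \<bullet> z s \<le> - \<beta> * (norm (z s))\<^sup>2"
          unfolding Z by (rule diss)
        show "(g (X, Y0) - \<epsilon> *\<^sub>R \<Gamma>' \<epsilon> X (f (X, Y0))) \<bullet> z s \<le> R * \<epsilon> ^ 3 * norm (z s)"
          using R(2)[OF \<epsilon>(1) \<epsilon>1, of X]
          by (intro order_trans[OF norm_cauchy_schwarz] mult_right_mono) (simp_all add: Y0_def X_def)
        have "norm (\<Gamma>' \<epsilon> X (f (X, Y) - f (X, Y0))) \<le> M * (L * norm (z s))"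
          using L(2)[of "(X, Y0)" "(0, z s)"]
          by (intro order_trans[OF \<Gamma>'_bound[OF \<epsilon>(1) \<epsilon>1]] mult_left_mono M) (simp add: Z norm_Pair)
        then have "norm (- (\<epsilon> *\<^sub>R \<Gamma>' \<epsilon> X (f (X, Y) - f (X, Y0)))) \<le> \<epsilon> * (M * (L * norm (z s)))"
          using \<epsilon> by simp
        then have "norm (- (\<epsilon> *\<^sub>R \<Gamma>' \<epsilon> X (f (X, Y) - f (X, Y0)))) * norm (z s)
            \<le> \<epsilon> * (M * (L * norm (z s))) * norm (z s)"
          by (rule mult_right_mono) simp
        then show "(- (\<epsilon> *\<^sub>R \<Gamma>' \<epsilon> X (f (X, Y) - f (X, Y0)))) \<bullet> z s \<le> \<epsilon> * (M * L) * (norm (z s))\<^sup>2"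
          by (intro order_trans[OF norm_cauchy_schwarz]) (simp add: power2_eq_square mult_ac)
      qed
      also have "\<epsilon> * (M * L) * (norm (z s))\<^sup>2 \<le> \<beta> / 4 * (norm (z s))\<^sup>2"
        by (rule mult_right_mono[OF small]) simp
      also have "R * \<epsilon> ^ 3 * norm (z s) \<le> R\<^sup>2 / \<beta> * \<epsilon> ^ 6 + \<beta> / 4 * (norm (z s))\<^sup>2"
      proof -
        \<comment> \<open>Young's inequality, multiplied by 4 \<beta>.\<close>
        have "0 \<le> (2 * R * \<epsilon> ^ 3 - \<beta> * norm (z s))\<^sup>2" by simp
        also have "\<dots> = 4 * \<beta> * (R\<^sup>2 / \<beta> * \<epsilon> ^ 6 + \<beta> / 4 * (norm (z s))\<^sup>2 - R * \<epsilon> ^ 3 * norm (z s))"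
          using \<beta> by (simp add: power2_eq_square field_simps eval_nat_numeral)
        finally show ?thesis using \<beta> by (simp add: zero_le_mult_iff)
      qed
      finally have "\<epsilon> * (z s \<bullet> z' s) \<le> R\<^sup>2 / \<beta> * \<epsilon> ^ 6 - \<beta> / 2 * (norm (z s))\<^sup>2"
        by simp
      then have "2 / \<epsilon> * (\<epsilon> * (z s \<bullet> z' s)) \<le> 2 / \<epsilon> * (R\<^sup>2 / \<beta> * \<epsilon> ^ 6 - \<beta> / 2 * (norm (z s))\<^sup>2)"
        using \<epsilon>(1) by (intro mult_left_mono) auto
      also have "\<dots> = (\<beta> / \<epsilon>) * (2 * R\<^sup>2 / \<beta>\<^sup>2 * \<epsilon> ^ 6 - (norm (z s))\<^sup>2)"
        using \<epsilon>(1) \<beta> by (simp add: right_diff_distrib power2_eq_square)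
      finally show ?thesis
        using \<epsilon>(1) by simp
    qed
    have "(norm (z t))\<^sup>2 \<le> 2 * R\<^sup>2 / \<beta>\<^sup>2 * \<epsilon> ^ 6 + exp (- (\<beta> / \<epsilon>) * t) * (norm (z 0))\<^sup>2"
    proof (rule linear_differential_inequality[where u = "\<lambda>s. (norm (z s))\<^sup>2", OF _ energy _ t])
      show "((\<lambda>s. (norm (z s))\<^sup>2) has_real_derivative 2 * (z s \<bullet> z' s)) (at s within {0..})" if s: "s \<ge> 0" for s
      proof -
        have "((\<lambda>s. z s \<bullet> z s) has_derivative (\<lambda>h. z s \<bullet> (h *\<^sub>R z' s) + (h *\<^sub>R z' s) \<bullet> z s)) (at s within {0..})"
          using has_derivative_inner[OF dz[OF s, unfolded has_vector_derivative_def]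
              dz[OF s, unfolded has_vector_derivative_def]] .
        moreover have "(\<lambda>h. z s \<bullet> (h *\<^sub>R z' s) + (h *\<^sub>R z' s) \<bullet> z s) = (*) (2 * (z s \<bullet> z' s))"
          by (auto simp: inner_commute)
        ultimately show ?thesis
          by (simp add: has_field_derivative_def power2_norm_eq_inner)
      qed
    qed (use \<epsilon> in simp)
    also have "2 * R\<^sup>2 / \<beta>\<^sup>2 * \<epsilon> ^ 6 \<le> C * \<epsilon> ^ 6"
      by (rule mult_right_mono) (use \<epsilon> in \<open>simp_all add: C_def\<close>)
    finally show "(norm (z t))\<^sup>2 \<le> C * \<epsilon> ^ 6 + exp (- (\<beta> / \<epsilon>) * t) * (norm (z 0))\<^sup>2"
      by simp
  qed
  have "C > 0" by (simp add: C_def add_nonneg_pos)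
  moreover have "\<forall>\<^sub>F \<epsilon> in at_right 0. 0 < \<epsilon> \<and> \<epsilon> < \<epsilon>0"
    using \<epsilon>0 by (auto simp: eventually_at_right)
  ultimately show ?thesis
  proof (intro exI[of _ C] conjI)
    assume ev: "\<forall>\<^sub>F \<epsilon> in at_right 0. 0 < \<epsilon> \<and> \<epsilon> < \<epsilon>0"
    show "\<forall>\<^sub>F \<epsilon> in at_right 0. \<forall>x y z.
      (\<forall>t\<ge>0. (x has_vector_derivative f (x t, y t)) (at t within {0..}) \<and>
        (y has_vector_derivative (1 / \<epsilon>) *\<^sub>R g (x t, y t)) (at t within {0..})) \<longrightarrow>
      (\<forall>t. z t = y t - (\<gamma> (x t) + \<epsilon> *\<^sub>R \<gamma>\<^sub>1 (x t) + \<epsilon>\<^sup>2 *\<^sub>R \<gamma>\<^sub>2 (x t))) \<longrightarrow>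
      (\<forall>t\<ge>0. (norm (z t))\<^sup>2 \<le> C * \<epsilon> ^ 6 + exp (- (\<beta> / \<epsilon>) * t) * (norm (z 0))\<^sup>2)"
      using ev
    proof (rule eventually_mono)
      fix \<epsilon> assume "0 < \<epsilon> \<and> \<epsilon> < \<epsilon>0"
      then show "\<forall>x y z.
        (\<forall>t\<ge>0. (x has_vector_derivative f (x t, y t)) (at t within {0..}) \<and>
          (y has_vector_derivative (1 / \<epsilon>) *\<^sub>R g (x t, y t)) (at t within {0..})) \<longrightarrow>
        (\<forall>t. z t = y t - (\<gamma> (x t) + \<epsilon> *\<^sub>R \<gamma>\<^sub>1 (x t) + \<epsilon>\<^sup>2 *\<^sub>R \<gamma>\<^sub>2 (x t))) \<longrightarrow>
        (\<forall>t\<ge>0. (norm (z t))\<^sup>2 \<le> C * \<epsilon> ^ 6 + exp (- (\<beta> / \<epsilon>) * t) * (norm (z 0))\<^sup>2)"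
        using main[of \<epsilon>] unfolding \<Gamma>_def by blast
    qed
  qed
qed

section \<open>The expansion in coordinates\<close>

lemma has_derivative_slice:
  assumes "bounded_gradient k h"
  shows "((\<lambda>y. h (x, y)) has_derivative (\<lambda>u. frechet_derivative h (at (x, y)) (0, u))) (at y)"
  by (rule has_derivative_compose[OF has_derivative_Pair[OF has_derivative_const has_derivative_ident]
        bounded_gradient_has_derivative[OF assms]])

lemma jacobian_mult_eq:
  fixes h :: "real^'n \<Rightarrow> real^'m"
  assumes "(h has_derivative h') (at x)"
  shows "jacobian h (at x) *v u = h' u"
  unfolding jacobian_def frechet_derivative_at[OF assms, symmetric]
  using matrix_vector_mul(2)[OF has_derivative_linear[OF assms]] by (rule fun_cong)

lemma sum_Basis_prod:
  fixes h :: "'a::euclidean_space \<times> 'b::euclidean_space \<Rightarrow> 'c::comm_monoid_add"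
  shows "sum h Basis = (\<Sum>b\<in>Basis. h (b, 0)) + (\<Sum>c\<in>Basis. h (0, c))"
  unfolding Basis_prod_def
  by (subst sum.union_disjoint) (auto simp: sum.reindex inj_on_def)

lemma sum_Basis_vec:
  fixes h :: "real^'m \<Rightarrow> 'a::comm_monoid_add"
  shows "sum h Basis = (\<Sum>k\<in>UNIV. h (axis k 1))"
proof -
  have B: "(Basis :: (real^'m) set) = range (\<lambda>k. axis k 1)"
    by (auto simp: Basis_vec_def)
  have "inj (\<lambda>k. axis k 1 :: real^'m)"
    by (auto simp: inj_def axis_eq_axis)
  then show ?thesis unfolding B by (simp add: sum.reindex)
qed

lemma partial_deriv_component:
  assumes "bounded_gradient k h"
  shows "partial_deriv j (\<lambda>y. h (x, y) $ i) y = frechet_derivative h (at (x, y)) (0, axis j 1) $ i"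
  unfolding partial_deriv_def
  using frechet_derivative_at[OF bounded_linear.has_derivative[OF bounded_linear_vec_nth
        has_derivative_slice[OF assms]]] by metis

text \<open>Vanishing x-components leave only the y-directions of the basis. In
  \<open>slow_Gyy\<close> the index k is the inner derivative, so k belongs to the second argument
  of \<open>second_derivative\<close> and j to the first.\<close>

lemma slow_Gyy_eq_second_derivative:
  fixes g :: "(real^'n) \<times> (real^'m) \<Rightarrow> real^'m"
  assumes g: "bounded_gradient 1 g"
  shows "(\<chi> i. \<Sum>j\<in>UNIV. \<Sum>k\<in>UNIV. slow_Gyy g \<gamma> i j k x * u $ j * u $ k)
    = second_derivative g (x, \<gamma> x) (0, u) (0, u)"
proof -
  define \<delta> where "\<delta> = (\<lambda>k p. frechet_derivative g (at p) (0, axis k 1 :: real^'m))"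
  have \<delta>: "bounded_gradient 0 (\<delta> k)" for k
    unfolding \<delta>_def using bounded_gradient_partial[of 0 g] g by (simp add: Basis_prod_def axis_in_Basis_iff)
  have Gyy: "slow_Gyy g \<gamma> i j k x = frechet_derivative (\<delta> k) (at (x, \<gamma> x)) (0, axis j 1) $ i" for i j k
    unfolding slow_Gyy_def partial_deriv_component[OF g] \<delta>_def[symmetric]
    using partial_deriv_component[OF \<delta>[unfolded \<delta>_def]] by (simp add: \<delta>_def)
  have expand: "frechet_derivative (\<delta> k) (at (x, \<gamma> x)) (0, u)
      = (\<Sum>j\<in>UNIV. u $ j *\<^sub>R frechet_derivative (\<delta> k) (at (x, \<gamma> x)) (0, axis j 1))" for k
    by (subst linear_Basis_expansion[OF bounded_gradient_linear[OF \<delta>]])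
      (simp add: sum_Basis_prod sum_Basis_vec inner_axis)
  have "second_derivative g (x, \<gamma> x) (0, u) (0, u)
      = (\<Sum>k\<in>UNIV. u $ k *\<^sub>R (\<Sum>j\<in>UNIV. u $ j *\<^sub>R frechet_derivative (\<delta> k) (at (x, \<gamma> x)) (0, axis j 1)))"
    unfolding expand[symmetric]
    by (simp add: second_derivative_def sum_Basis_prod sum_Basis_vec inner_axis \<delta>_def)
  also have "\<dots> = (\<chi> i. \<Sum>k\<in>UNIV. \<Sum>j\<in>UNIV. slow_Gyy g \<gamma> i j k x * u $ j * u $ k)"
    by (simp add: vec_eq_iff Gyy sum_distrib_left mult_ac)
  \<comment> \<open>The expansion yields k as the outer summation index; the definition of
    \<open>gamma2\<close> has j outside.\<close>
  also have "\<dots> = (\<chi> i. \<Sum>j\<in>UNIV. \<Sum>k\<in>UNIV. slow_Gyy g \<gamma> i j k x * u $ j * u $ k)"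
    by (subst sum.swap) (rule refl)
  finally show ?thesis by simp
qed

text \<open>Converts the explicit formulas for the coefficients into the linear equations used so
  far. \<open>matrix_inv\<close> is defined by choice; coercivity makes the square matrix injective,
  hence invertible, so that the chosen matrix is an inverse.\<close>

lemma slow_Gy_solve:
  fixes g :: "(real^'n) \<times> (real^'m) \<Rightarrow> real^'m"
  assumes g: "bounded_gradient k g" and \<beta>: "\<beta> > 0"
    and diss: "\<And>x y y'. (g (x, y) - g (x, y')) \<bullet> (y - y') \<le> - \<beta> * (norm (y - y'))\<^sup>2"
  shows "frechet_derivative g (at (x, \<gamma> x)) (0, matrix_inv (slow_Gy g \<gamma> x) *v w) = w"
proof -
  have Gy: "slow_Gy g \<gamma> x *v u = frechet_derivative g (at (x, \<gamma> x)) (0, u)" for u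
    unfolding slow_Gy_def by (rule jacobian_mult_eq[OF has_derivative_slice[OF g]])
  have "inj ((*v) (slow_Gy g \<gamma> x))"
    by (rule coercive_inj[OF matrix_vector_mul_linear \<beta>]) (unfold Gy, rule frechet_coercive[OF g diss])
  then have "invertible (slow_Gy g \<gamma> x)"
    using matrix_left_invertible_injective invertible_left_inverse by blast
  then have "slow_Gy g \<gamma> x ** matrix_inv (slow_Gy g \<gamma> x) = mat 1"
    unfolding invertible_def matrix_inv_def by (rule someI2_ex) blast
  then have "slow_Gy g \<gamma> x *v (matrix_inv (slow_Gy g \<gamma> x) *v w) = w"
    by (simp add: matrix_vector_mul_assoc)
  then show ?thesis unfolding Gy .
qed

theorem theorem3p4:
  fixes f :: "(real^'n) \<times> (real^'m) \<Rightarrow> real^'n"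
    and g :: "(real^'n) \<times> (real^'m) \<Rightarrow> real^'m"
    and \<gamma> :: "real^'n \<Rightarrow> real^'m"
    and \<beta> :: real
    and K :: nat
  assumes K: "2 \<le> K"
    and f_smooth: "class_C K f"
    and f_bounded: "W_infty K f"
    and g_smooth: "class_C (Suc K) g"
    and g_bounded: "grad_W_infty K g"
    and gamma_zero: "\<And>x. g (x, \<gamma> x) = 0"
    and beta_pos: "0 < \<beta>"
    and dissipative: "\<And>x y y'. (g (x, y) - g (x, y')) \<bullet> (y - y') \<le> - \<beta> * (norm (y - y'))^2"
  shows "(\<exists>C>0. \<forall>\<^sub>F \<epsilon> in at_right 0.
            \<forall>x0 y0 x y z. fast_slow_solution f g \<epsilon> x0 y0 x y \<longrightarrow>
              (\<forall>t. z t = y t - Gamma2_approx f g \<gamma> (x t) \<epsilon>) \<longrightarrow>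
              (\<forall>t\<ge>0. (norm (z t))^2 \<le> C * \<epsilon>^6 + exp (- (\<beta> / \<epsilon>) * t) * (norm (z 0))^2))
       \<and> (\<exists>C>0. \<forall>\<^sub>F \<epsilon> in at_right 0.
            \<forall>x0 y0 x y z. fast_slow_solution f g \<epsilon> x0 y0 x y \<longrightarrow>
              (\<forall>t. z t = y t - Gamma2_approx f g \<gamma> (x t) \<epsilon>) \<longrightarrow>
              (\<forall>\<^sub>F t in at_top. norm (z t) \<le> C * \<epsilon>^3))"
proof -
  \<comment> \<open>The hypothesis \<open>2 \<le> K\<close> enters here and for g: order 2 is the
    order at which the preceding lemmas work.\<close>
  have f: "bounded_derivs 2 f"
    by (rule bounded_derivs_mono[OF K W_infty_imp_bounded_derivs[OF f_smooth f_bounded]])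
  have g: "bounded_gradient 2 g"
    by (rule bounded_gradient_mono[OF K grad_W_infty_imp_bounded_gradient[OF g_smooth g_bounded]])
  have \<gamma>: "bounded_gradient 2 \<gamma>"
    by (rule slow_manifold_regularity[OF g beta_pos dissipative gamma_zero])
  have f1: "bounded_gradient 1 f"
    using f bounded_derivs_imp_gradient[of 1 f] by (simp add: numeral_2_eq_2)
  note solve = slow_Gy_solve[OF g beta_pos dissipative]
  have eq1: "frechet_derivative g (at (x, \<gamma> x)) (0, gamma1 f g \<gamma> x) = frechet_derivative \<gamma> (at x) (f (x, \<gamma> x))" for x
    unfolding gamma1_def solve slow_F_def by (rule jacobian_mult_eq[OF bounded_gradient_has_derivative[OF \<gamma>]])
  have \<gamma>\<^sub>1: "bounded_derivs 2 (gamma1 f g \<gamma>)"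
    by (rule first_coefficient_regularity[OF f g beta_pos dissipative \<gamma> eq1])
  have \<gamma>\<^sub>1': "bounded_gradient 1 (gamma1 f g \<gamma>)"
    using \<gamma>\<^sub>1 bounded_derivs_imp_gradient[of 1 "gamma1 f g \<gamma>"] by (simp add: numeral_2_eq_2)
  \<comment> \<open>The Jacobian of \<open>gamma1\<close> inside \<open>gamma2\<close> can be read
    as a derivative because \<open>gamma1\<close> is already known to be differentiable; its
    regularity must therefore come first.\<close>
  have eq2: "frechet_derivative g (at (x, \<gamma> x)) (0, gamma2 f g \<gamma> x) =
      frechet_derivative \<gamma> (at x) (frechet_derivative f (at (x, \<gamma> x)) (0, gamma1 f g \<gamma> x))
      + frechet_derivative (gamma1 f g \<gamma>) (at x) (f (x, \<gamma> x))
      - (1 / 2) *\<^sub>R second_derivative g (x, \<gamma> x) (0, gamma1 f g \<gamma> x) (0, gamma1 f g \<gamma> x)" for x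
    unfolding gamma2_def solve slow_F_def slow_Fy_def
      slow_Gyy_eq_second_derivative[OF bounded_gradient_mono[OF one_le_numeral g]]
      jacobian_mult_eq[OF has_derivative_slice[OF f1]]
      jacobian_mult_eq[OF bounded_gradient_has_derivative[OF \<gamma>]]
      jacobian_mult_eq[OF bounded_gradient_has_derivative[OF \<gamma>\<^sub>1']] ..
  have \<gamma>\<^sub>2: "bounded_derivs 1 (gamma2 f g \<gamma>)"
    by (rule second_coefficient_regularity[OF f g beta_pos dissipative \<gamma> \<gamma>\<^sub>1 eq2])
  obtain C where C: "C > 0" and attract: "\<forall>\<^sub>F \<epsilon> in at_right 0. \<forall>x0 y0 x y z.
      fast_slow_solution f g \<epsilon> x0 y0 x y \<longrightarrow> (\<forall>t. z t = y t - Gamma2_approx f g \<gamma> (x t) \<epsilon>) \<longrightarrow>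
      (\<forall>t\<ge>0. (norm (z t))\<^sup>2 \<le> C * \<epsilon> ^ 6 + exp (- (\<beta> / \<epsilon>) * t) * (norm (z 0))\<^sup>2)"
  proof -
    obtain C where C: "C > 0" and *: "\<forall>\<^sub>F \<epsilon> in at_right 0. \<forall>x y z.
      (\<forall>t\<ge>0. (x has_vector_derivative f (x t, y t)) (at t within {0..}) \<and>
        (y has_vector_derivative (1 / \<epsilon>) *\<^sub>R g (x t, y t)) (at t within {0..})) \<longrightarrow>
      (\<forall>t. z t = y t - (\<gamma> (x t) + \<epsilon> *\<^sub>R gamma1 f g \<gamma> (x t) + \<epsilon>\<^sup>2 *\<^sub>R gamma2 f g \<gamma> (x t))) \<longrightarrow>
      (\<forall>t\<ge>0. (norm (z t))\<^sup>2 \<le> C * \<epsilon> ^ 6 + exp (- (\<beta> / \<epsilon>) * t) * (norm (z 0))\<^sup>2)"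
      using approximate_slow_manifold_attracts[OF f g beta_pos dissipative gamma_zero
          bounded_gradient_imp_0[OF \<gamma>] bounded_derivs_mono[OF one_le_numeral \<gamma>\<^sub>1] \<gamma>\<^sub>2 eq1 eq2]
      by blast
    show ?thesis
      by (rule that[OF C eventually_mono[OF *]]) (unfold fast_slow_solution_def Gamma2_approx_def, blast)
  qed
  \<comment> \<open>After a time depending on \<epsilon> and z 0 the exponential term is below
    \<epsilon>^6, so the squared norm is at most (C + 1) \<epsilon>^6; hence the constant
    \<open>sqrt (C + 1)\<close>.\<close>
  have "\<forall>\<^sub>F \<epsilon> in at_right 0. \<forall>x0 y0 x y z. fast_slow_solution f g \<epsilon> x0 y0 x y \<longrightarrow>
      (\<forall>t. z t = y t - Gamma2_approx f g \<gamma> (x t) \<epsilon>) \<longrightarrow>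
      (\<forall>\<^sub>F t in at_top. norm (z t) \<le> sqrt (C + 1) * \<epsilon> ^ 3)"
    \<comment> \<open>The second conjunct retains 0 < \<epsilon>, which makes the exponent negative
      and \<epsilon>^6 positive.\<close>
    using eventually_conj[OF attract eventually_at_right_less]
  proof (rule eventually_mono, intro allI impI)
    fix \<epsilon> x0 y0 x y and z :: "real \<Rightarrow> real^'m"
    assume A: "(\<forall>x0 y0 x y z.
      fast_slow_solution f g \<epsilon> x0 y0 x y \<longrightarrow> (\<forall>t. z t = y t - Gamma2_approx f g \<gamma> (x t) \<epsilon>) \<longrightarrow>
      (\<forall>t\<ge>0. (norm (z t))\<^sup>2 \<le> C * \<epsilon> ^ 6 + exp (- (\<beta> / \<epsilon>) * t) * (norm (z 0))\<^sup>2)) \<and> 0 < \<epsilon>"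
      and sol: "fast_slow_solution f g \<epsilon> x0 y0 x y" "\<forall>t. z t = y t - Gamma2_approx f g \<gamma> (x t) \<epsilon>"
    have \<epsilon>: "0 < \<epsilon>" using A by blast
    have z: "(norm (z t))\<^sup>2 \<le> C * \<epsilon> ^ 6 + exp (- (\<beta> / \<epsilon>) * t) * (norm (z 0))\<^sup>2" if "t \<ge> 0" for t
      using A sol that by blast
    have "((\<lambda>t. exp (- (\<beta> / \<epsilon>) * t) * (norm (z 0))\<^sup>2) \<longlongrightarrow> 0 * (norm (z 0))\<^sup>2) at_top"
      using beta_pos \<epsilon>
      by (intro tendsto_mult tendsto_const filterlim_compose[OF exp_at_bot]
          filterlim_tendsto_neg_mult_at_bot[OF tendsto_const _ filterlim_ident]) simp
    then have "\<forall>\<^sub>F t in at_top. exp (- (\<beta> / \<epsilon>) * t) * (norm (z 0))\<^sup>2 < \<epsilon> ^ 6"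
      using \<epsilon> by (intro order_tendstoD(2)) auto
    with eventually_ge_at_top[of 0]
    show "\<forall>\<^sub>F t in at_top. norm (z t) \<le> sqrt (C + 1) * \<epsilon> ^ 3"
    proof eventually_elim
      case (elim t)
      have "(norm (z t))\<^sup>2 \<le> (C + 1) * \<epsilon> ^ 6"
        using z[OF elim(1)] elim(2) by (simp add: distrib_right)
      then have "(norm (z t))\<^sup>2 \<le> (sqrt (C + 1) * \<epsilon> ^ 3)\<^sup>2"
        using C by (simp add: power_mult_distrib power_mult[symmetric])
      then show ?case
        by (rule power2_le_imp_le) (use C \<epsilon> in simp)
    qed
  qed
  moreover have "sqrt (C + 1) > 0" using C by simp
  ultimately show ?thesis using C attract by blast
qed

end
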